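(* Consider a refracting piecewise-$C^3$ system $\dot{x} = f^L(x)$ for $H(x)<0$, $\dot{x} = f^R(x)$ for $H(x)>0$, on an open set $\Omega \subset \mathbb{R}^n$, with tangency surface $\mathcal{T}$. Suppose the forward [respectively, backward] orbit of a point $x \in \Omega \setminus \mathcal{T}$ intersects $\mathcal{T}$ in finite time. Then its first point of intersection with $\mathcal{T}$ does not belong to an invisible-invisible region.
   Context: Let $\Omega \subset \mathbb{R}^n$ be open. The system $\dot{x} = f^L(x)$ if $H(x)<0$, $\dot{x}=f^R(x)$ if $H(x)>0$ is piecewise-$C^k$ if $f^L, f^R : \Omega \to \mathbb{R}^n$ are $C^k$ and $H : \Omega \to \mathbb{R}$ is $C^{k+1}$ with $\nabla H(x) \ne 0$ for all $x \in \Sigma$, where $\Sigma = \{ x \in \Omega : H(x) = 0 \}$. Orbits of the system are Filippov solutions: absolutely continuous functions $\phi(t)$ with $\dot{\phi}(t) \in \mathcal{F}(\phi(t))$ for almost all $t$, where $\mathcal{F}(x) = \{f^L(x)\}$ if $H(x)<0$, $\mathcal{F}(x) = \{f^R(x)\}$ if $H(x)>0$, and $\mathcal{F}(x) = \{(1-s) f^L(x) + s f^R(x) : 0 \le s \le 1\}$ if $H(x)=0$. The forward [backward] orbit of $x$ is the Filippov solution $\phi(t)$ with $\phi(0)=x$, for $t \ge 0$ [$t \le 0$]. Lie derivatives: $\mathcal{L}_f^0 h = h$ and $\mathcal{L}_f^m h(x) = (\nabla \mathcal{L}_f^{m-1} h(x))^{\sf T} f(x)$ for $m \ge 1$; $\mathcal{L}_f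 h = \mathcal{L}_f^1 h$. The system is refracting if $\mathcal{L}_{f^L} H(x) = \mathcal{L}_{f^R} H(x)$ for all $x \in \Sigma$. The tangency surface is $\mathcal{T} = \{ x \in \Sigma : \mathcal{L}_{f^L} H(x) = 0 \} = \{ x \in \Sigma : \mathcal{L}_{f^R} H(x) = 0 \}$. A subset $S \subset \mathcal{T}$ is an invisible-invisible region if $\mathcal{L}_{f^L}^2 H(x) > 0$ and $\mathcal{L}_{f^R}^2 H(x) < 0$ for all $x \in S$. *)

theory Defs
  imports "HOL-Analysis.Analysis"
begin

section \<open>Calculus\<close>

text \<open>Intended for open \<open>S\<close> in a finite-dimensional space: all iterated directional derivatives up
  to order \<open>k\<close> exist, as values of Frechet derivatives, and are continuous.\<close>

primrec Ck_on :: "nat \<Rightarrow> 'a::euclidean_space set \<Rightarrow> ('a \<Rightarrow> 'b::real_normed_vector) \<Rightarrow> bool" where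
  "Ck_on 0 S f \<longleftrightarrow> continuous_on S f"
| "Ck_on (Suc k) S f \<longleftrightarrow>
     (\<forall>x\<in>S. f differentiable (at x)) \<and> (\<forall>v. Ck_on k S (\<lambda>x. frechet_derivative f (at x) v))"

definition gradient :: "('a::euclidean_space \<Rightarrow> real) \<Rightarrow> 'a \<Rightarrow> 'a" where
  "gradient h x = (THE D. GDERIV h x :> D)"

lemma gradient_eq:
  assumes "GDERIV h x :> D"
  shows "gradient h x = D"
  unfolding gradient_def
proof (rule the_equality[where a = D])
  show "GDERIV h x :> D" by (fact assms)
next
  fix E assume "GDERIV h x :> E"
  then have "(\<lambda>v. v \<bullet> E) = (\<lambda>v. v \<bullet> D)"
    using assms unfolding gderiv_def by (rule has_derivative_unique)
  then have "\<forall>v. v \<bullet> E = v \<bullet> D"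
    by (simp add: fun_eq_iff)
  then show "E = D"
    by (simp only: vector_eq_ldot)
qed

primrec lie_deriv ::
  "nat \<Rightarrow> ('a::euclidean_space \<Rightarrow> 'a) \<Rightarrow> ('a \<Rightarrow> real) \<Rightarrow> 'a \<Rightarrow> real" where
  "lie_deriv 0 f h = h"
| "lie_deriv (Suc m) f h = (\<lambda>x. gradient (lie_deriv m f h) x \<bullet> f x)"

text \<open>The \<open>\<epsilon>\<close>-\<open>\<delta>\<close> definition; \<open>D division_of \<Union>D\<close> says that \<open>D\<close> is a finite family of non-overlapping
  nonempty compact intervals.\<close>

definition abs_continuous_on :: "real set \<Rightarrow> (real \<Rightarrow> 'a::real_normed_vector) \<Rightarrow> bool" where
  "abs_continuous_on S f \<longleftrightarrow>
     (\<forall>\<epsilon>>0. \<exists>\<delta>>0. \<forall>D. D division_of \<Union>D \<and> \<Union>D \<subseteq> S \<and> (\<Sum>K\<in>D. Sup K - Inf K) < \<delta> \<longrightarrow>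
        (\<Sum>K\<in>D. norm (f (Sup K) - f (Inf K))) < \<epsilon>)"


section \<open>Piecewise-smooth systems\<close>

definition switching_surface :: "'a set \<Rightarrow> ('a \<Rightarrow> real) \<Rightarrow> 'a set" where
  "switching_surface \<Omega> H = {x \<in> \<Omega>. H x = 0}"

definition piecewise_Ck ::
  "nat \<Rightarrow> 'a::euclidean_space set \<Rightarrow> ('a \<Rightarrow> 'a) \<Rightarrow> ('a \<Rightarrow> 'a) \<Rightarrow> ('a \<Rightarrow> real) \<Rightarrow> bool" where
  "piecewise_Ck k \<Omega> fL fR H \<longleftrightarrow>
     open \<Omega> \<and> Ck_on k \<Omega> fL \<and> Ck_on k \<Omega> fR \<and> Ck_on (k + 1) \<Omega> H \<and>
     (\<forall>x \<in> switching_surface \<Omega> H. gradient H x \<noteq> 0)"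

definition refracting ::
  "'a::euclidean_space set \<Rightarrow> ('a \<Rightarrow> 'a) \<Rightarrow> ('a \<Rightarrow> 'a) \<Rightarrow> ('a \<Rightarrow> real) \<Rightarrow> bool" where
  "refracting \<Omega> fL fR H \<longleftrightarrow>
     (\<forall>x \<in> switching_surface \<Omega> H. lie_deriv 1 fL H x = lie_deriv 1 fR H x)"

text \<open>For refracting systems the choice of \<open>fL\<close> or \<open>fR\<close> is immaterial.\<close>

definition tangency_surface ::
  "'a::euclidean_space set \<Rightarrow> ('a \<Rightarrow> 'a) \<Rightarrow> ('a \<Rightarrow> real) \<Rightarrow> 'a set" where
  "tangency_surface \<Omega> f H = {x \<in> switching_surface \<Omega> H. lie_deriv 1 f H x = 0}"

lemma tangency_surface_refracting:
  "refracting \<Omega> fL fR H \<Longrightarrow> tangency_surface \<Omega> fL H = tangency_surface \<Omega> fR H"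
  by (auto simp: refracting_def tangency_surface_def)

definition invisible_invisible_region ::
  "'a::euclidean_space set \<Rightarrow> ('a \<Rightarrow> 'a) \<Rightarrow> ('a \<Rightarrow> 'a) \<Rightarrow> ('a \<Rightarrow> real) \<Rightarrow> 'a set \<Rightarrow> bool" where
  "invisible_invisible_region \<Omega> fL fR H S \<longleftrightarrow>
     S \<subseteq> tangency_surface \<Omega> fL H \<and>
     (\<forall>x\<in>S. lie_deriv 2 fL H x > 0 \<and> lie_deriv 2 fR H x < 0)"


section \<open>Filippov solutions and orbits\<close>

definition filippov_set ::
  "('a::real_vector \<Rightarrow> 'a) \<Rightarrow> ('a \<Rightarrow> 'a) \<Rightarrow> ('a \<Rightarrow> real) \<Rightarrow> 'a \<Rightarrow> 'a set" where
  "filippov_set fL fR H x =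
     (if H x < 0 then {fL x}
      else if H x > 0 then {fR x}
      else {(1 - s) *\<^sub>R fL x + s *\<^sub>R fR x | s. 0 \<le> s \<and> s \<le> 1})"

text \<open>Absolute continuity is required on compact subintervals, since \<open>I\<close> need not be compact.\<close>

definition filippov_solution ::
  "'a::euclidean_space set \<Rightarrow> ('a \<Rightarrow> 'a) \<Rightarrow> ('a \<Rightarrow> 'a) \<Rightarrow> ('a \<Rightarrow> real) \<Rightarrow>
     real set \<Rightarrow> (real \<Rightarrow> 'a) \<Rightarrow> bool" where
  "filippov_solution \<Omega> fL fR H I \<phi> \<longleftrightarrow>
     is_interval I \<and> \<phi> ` I \<subseteq> \<Omega> \<and>
     (\<forall>a b. {a..b} \<subseteq> I \<longrightarrow> abs_continuous_on {a..b} \<phi>) \<and>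
     (AE t in lborel. t \<in> I \<longrightarrow>
        (\<exists>v \<in> filippov_set fL fR H (\<phi> t). (\<phi> has_vector_derivative v) (at t within I)))"

text \<open>Neither maximality of the time interval \<open>I\<close> nor uniqueness of the solution is built in; results
  quantify over all \<open>I\<close> and \<open>\<phi>\<close>.\<close>

definition forward_orbit ::
  "'a::euclidean_space set \<Rightarrow> ('a \<Rightarrow> 'a) \<Rightarrow> ('a \<Rightarrow> 'a) \<Rightarrow> ('a \<Rightarrow> real) \<Rightarrow>
     'a \<Rightarrow> real set \<Rightarrow> (real \<Rightarrow> 'a) \<Rightarrow> bool" where
  "forward_orbit \<Omega> fL fR H x I \<phi> \<longleftrightarrow>
     0 \<in> I \<and> I \<subseteq> {0..} \<and> filippov_solution \<Omega> fL fR H I \<phi> \<and> \<phi> 0 = x"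

definition backward_orbit ::
  "'a::euclidean_space set \<Rightarrow> ('a \<Rightarrow> 'a) \<Rightarrow> ('a \<Rightarrow> 'a) \<Rightarrow> ('a \<Rightarrow> real) \<Rightarrow>
     'a \<Rightarrow> real set \<Rightarrow> (real \<Rightarrow> 'a) \<Rightarrow> bool" where
  "backward_orbit \<Omega> fL fR H x I \<phi> \<longleftrightarrow>
     0 \<in> I \<and> I \<subseteq> {..0} \<and> filippov_solution \<Omega> fL fR H I \<phi> \<and> \<phi> 0 = x"

text \<open>The absolute values make this the earliest time on forward orbits and the latest (nearest to \<open>0\<close>)
  time on backward orbits.\<close>

definition first_hitting_time :: "real set \<Rightarrow> (real \<Rightarrow> 'a) \<Rightarrow> 'a set \<Rightarrow> real \<Rightarrow> bool" where
  "first_hitting_time I \<phi> A \<tau> \<longleftrightarrow>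
     \<tau> \<in> I \<and> \<phi> \<tau> \<in> A \<and> (\<forall>t\<in>I. \<phi> t \<in> A \<longrightarrow> \<bar>\<tau>\<bar> \<le> \<bar>t\<bar>)"

end

theory Submission
  imports Defs
begin

text \<open>
  For \<open>f\<close> either of the two fields, the quantity \<open>(L\<^sub>f H)\<^sup>2 / 2 - H \<cdot> L\<^sub>f\<^sup>2 H\<close> has derivative
  \<open>- H \<cdot> L\<^sub>f\<^sup>3 H\<close> along orbits of \<open>f\<close>. On the switching surface both quantities equal
  \<open>(L\<^sub>f H)\<^sup>2 / 2\<close>, which is the same for both fields since the system is refracting; so they glue to a
  continuous function \<open>E\<close> that vanishes on the tangency surface. Near an invisible-invisible point
  \<open>E\<close> is positive off the tangency surface and \<open>E \<ge> \<bar>H\<bar> \<cdot> \<bar>L\<^sub>f\<^sup>2 H\<bar>\<close>, hence \<open>\<bar>E'\<bar> \<le> C E\<close> along a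
  solution except at its crossings of the switching surface, which are isolated until the tangency
  surface is reached. By Gronwall's inequality, forward and backward in time, \<open>E\<close> cannot reach \<open>0\<close>.
\<close>

section \<open>Absolutely continuous functions\<close>

text \<open>Tags in the exceptional set only contribute intervals inside an open set of small measure,
  on which absolute continuity bounds the increments.\<close>

lemma abs_continuous_on_fundamental_theorem:
  fixes f :: "real \<Rightarrow> 'a::banach"
  assumes "a \<le> b" and ac: "abs_continuous_on {a..b} f" and N: "negligible N"
    and vecd: "\<And>x. x \<in> {a..b} - N \<Longrightarrow> (f has_vector_derivative f' x) (at x within {a..b})"
  shows "(f' has_integral (f b - f a)) {a..b}"
proof (cases "a = b")
  case True
  then show ?thesis by (metis cancel_comm_monoid_add_class.diff_cancel cbox_interval has_integral_refl(1) interval_cbox)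
next
  case False
  with \<open>a \<le> b\<close> have "a < b" by simp
  \<comment> \<open>Changing the integrand on a null set leaves the integral alone; with value 0
    there, a tag in \<open>N\<close> contributes nothing but the increment of \<open>f\<close> to
    the error.\<close>
  define g where "g x = (if x \<in> N then 0 else f' x)" for x
  have "(g has_integral (f b - f a)) {a..b}"
    unfolding has_integral_factor_content_real
  proof safe
    fix e :: real
    assume "e > 0"
    then have e2: "e / 2 > 0" and eps: "e / 2 * (b - a) > 0"
      using \<open>a < b\<close> by auto
    \<comment> \<open>The permitted error \<open>e * (b - a)\<close> is split in half: one half for
      the tags in \<open>N\<close>, controlled by absolute continuity, the other for the remaining
      tags.\<close>
    obtain \<delta> where "\<delta> > 0" and \<delta>: "\<And>D. \<lbrakk>D division_of \<Union>D; \<Union>D \<subseteq> {a..b}; (\<Sum>K\<in>D. Sup K - Inf K) < \<delta>\<rbrakk>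
         \<Longrightarrow> (\<Sum>K\<in>D. norm (f (Sup K) - f (Inf K))) < e / 2 * (b - a)"
      using ac eps unfolding abs_continuous_on_def by meson
    have Nl: "N \<in> sets lebesgue" "emeasure lebesgue N = 0"
      using N by (auto simp: negligible_iff_null_sets null_sets_def)
    obtain U where "open U" "N \<subseteq> U" and UN: "U - N \<in> lmeasurable" "emeasure lebesgue (U - N) < ennreal \<delta>"
      using sets_lebesgue_outer_open[OF Nl(1) \<open>\<delta> > 0\<close>] by blast
    have U: "U \<in> lmeasurable" "measure lebesgue U < \<delta>"
    proof -
      have eq: "U = (U - N) \<union> N" using \<open>N \<subseteq> U\<close> by auto
      show "U \<in> lmeasurable"
        by (subst eq) (use UN(1) N negligible_imp_measurable in blast)
      have "measure lebesgue U = measure lebesgue (U - N)"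
        using \<open>U \<in> lmeasurable\<close> N by (metis measure_Diff_null_set negligible_iff_null_sets fmeasurableD)
      also have "\<dots> < \<delta>"
        using UN \<open>\<delta> > 0\<close> by (simp add: emeasure_eq_measure2 ennreal_less_iff)
      finally show "measure lebesgue U < \<delta>" .
    qed
    \<comment> \<open>The gauge has two regimes: off \<open>N\<close> it is a radius of good linear
      approximation, on \<open>N\<close> it keeps the interval of the tag inside
      \<open>U\<close>.\<close>
    have "\<forall>x. \<exists>d>0. (x \<in> {a..b} - N \<longrightarrow>
         (\<forall>y\<in>{a..b}. norm (y-x) < d \<longrightarrow> norm (f y - f x - (y-x) *\<^sub>R f' x) \<le> e/2 * norm (y-x)))
         \<and> (x \<in> N \<longrightarrow> ball x d \<subseteq> U)"
    proof
      fix x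
      show "\<exists>d>0. (x \<in> {a..b} - N \<longrightarrow>
         (\<forall>y\<in>{a..b}. norm (y-x) < d \<longrightarrow> norm (f y - f x - (y-x) *\<^sub>R f' x) \<le> e/2 * norm (y-x)))
         \<and> (x \<in> N \<longrightarrow> ball x d \<subseteq> U)"
      proof (cases "x \<in> N")
        case True
        then show ?thesis using \<open>open U\<close> \<open>N \<subseteq> U\<close> by (auto simp: open_contains_ball)
      next
        case False
        then show ?thesis
          using vecd[of x, unfolded has_vector_derivative_def has_derivative_within_alt] e2
          by (cases "x \<in> {a..b}") (blast, blast intro: zero_less_one)
      qed
    qed
    then obtain d where d: "\<And>x. 0 < d x"
                 "\<And>x y. \<lbrakk>x \<in> {a..b} - N; y \<in> {a..b}; norm (y-x) < d x\<rbrakk>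
                        \<Longrightarrow> norm (f y - f x - (y-x) *\<^sub>R f' x) \<le> e/2 * norm (y-x)"
                 "\<And>x. x \<in> N \<Longrightarrow> ball x (d x) \<subseteq> U"
      by metis
    show "\<exists>d. gauge d \<and> (\<forall>p. p tagged_division_of {a..b} \<and> d fine p \<longrightarrow>
      norm ((\<Sum>(x, k)\<in>p. measure lborel k *\<^sub>R g x) - (f b - f a)) \<le> e * measure lborel {a..b})"
    proof (rule exI, safe)
      show "gauge (\<lambda>x. ball x (d x))"
        using d(1) gauge_ball_dependent by blast
    next
      fix p
      assume ptag: "p tagged_division_of {a..b}" and finep: "(\<lambda>x. ball x (d x)) fine p"
      have "finite p" using ptag by blast
      have ba: "b - a = (\<Sum>(x,K)\<in>p. Sup K - Inf K)" "f b - f a = (\<Sum>(x,K)\<in>p. f(Sup K) - f(Inf K))"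
        using additive_tagged_division_1[where f= "\<lambda>x. x"] additive_tagged_division_1[where f= f]
              \<open>a \<le> b\<close> ptag by auto
      have K: "\<exists>u v. K = {u..v} \<and> u \<le> v \<and> x \<in> {u..v} \<and> {u..v} \<subseteq> {a..b}" if "(x, K) \<in> p" for x K
        using tagged_division_ofD(2-4)[OF ptag that] by (metis atLeastAtMost_iff box_real(2) order_trans)
      define q where "q = {(x, K) \<in> p. x \<in> N}"
      have "q \<subseteq> p" by (auto simp: q_def)
      define T where "T = (\<lambda>(x, K). measure lborel K *\<^sub>R g x - (f (Sup K) - f (Inf K)))"
      have "norm (sum T (p - q)) \<le> (\<Sum>n\<in>p - q. e/2 * (case n of (x, k) \<Rightarrow> Sup k - Inf k))"
      proof (rule sum_norm_le, safe)
        fix x K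
        assume xK: "(x, K) \<in> p" "(x, K) \<notin> q"
        then have "x \<notin> N" by (auto simp: q_def)
        obtain u v where k: "K = {u..v}" "u \<le> v" "x \<in> {u..v}" "{u..v} \<subseteq> {a..b}"
          using K[OF xK(1)] by blast
        have ball: "K \<subseteq> ball x (d x)"
          using finep xK by blast
        \<comment> \<open>The increment is split at the tag. As the tag lies between
          \<open>u\<close> and \<open>v\<close>, the two distances add up to exactly
          \<open>v - u\<close>.\<close>
        have "norm ((v - u) *\<^sub>R f' x - (f v - f u)) = norm (f u - f x - (u - x) *\<^sub>R f' x - (f v - f x - (v - x) *\<^sub>R f' x))"
          by (auto simp: algebra_simps)
        also have "\<dots> \<le> norm (f u - f x - (u - x) *\<^sub>R f' x) + norm (f v - f x - (v - x) *\<^sub>R f' x)"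
          by (rule norm_triangle_ineq4)
        also have "\<dots> \<le> e/2 * norm (u - x) + e/2 * norm (v - x)"
          using k ball[unfolded k(1), THEN subsetD, of u] ball[unfolded k(1), THEN subsetD, of v] \<open>x \<notin> N\<close>
          by (intro add_mono d(2)) (auto simp: dist_real_def)
        also have "\<dots> = e/2 * (Sup K - Inf K)"
          using k by (auto simp: field_simps)
        finally show "norm (T (x, K)) \<le> e/2 * (Sup K - Inf K)"
          using k \<open>x \<notin> N\<close> by (simp add: T_def g_def)
      qed
      also have "\<dots> \<le> (\<Sum>n\<in>p. e/2 * (case n of (x, k) \<Rightarrow> Sup k - Inf k))"
        using K e2 \<open>finite p\<close> by (intro sum_mono2) fastforce+
      also have "\<dots> = e/2 * (b - a)"
        by (simp add: ba(1) sum_distrib_left)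
      finally have good: "norm (sum T (p - q)) \<le> e/2 * (b - a)" .
      have qpart: "q tagged_partial_division_of {a..b}"
        using ptag \<open>q \<subseteq> p\<close> by (meson tagged_division_of_def tagged_partial_division_subset)
      note qtag = tagged_partial_division_of_Union_self[OF qpart]
      note qdiv = partial_division_of_tagged_division[OF qpart]
      \<comment> \<open>The intervals tagged in \<open>N\<close> do not overlap and lie in
        \<open>U\<close>, so their total length is at most the measure of \<open>U\<close>, hence
        below \<open>\<delta>\<close>.\<close>
      have "(\<Sum>K\<in>snd ` q. Sup K - Inf K) = (\<Sum>K\<in>snd ` q. measure lebesgue K)"
      proof (rule sum.cong)
        fix K' assume "K' \<in> snd ` q"
        then obtain x where "(x, K') \<in> p" using \<open>q \<subseteq> p\<close> by auto
        from K[OF this] show "Sup K' - Inf K' = measure lebesgue K'" by auto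
      qed simp
      also have "\<dots> = measure lebesgue (\<Union>(snd ` q))"
        by (rule content_division[OF qdiv])
      also have "\<dots> \<le> measure lebesgue U"
      proof (rule measure_mono_fmeasurable)
        show "\<Union>(snd ` q) \<subseteq> U"
        proof safe
          fix x K y assume "(x, K) \<in> q" "y \<in> snd (x, K)"
          then have "x \<in> N" "(x, K) \<in> p" "y \<in> K" by (auto simp: q_def)
          then show "y \<in> U" using finep d(3) by blast
        qed
        show "\<Union>(snd ` q) \<in> sets lebesgue" using lmeasurable_division[OF qdiv] by blast
      qed (use U in auto)
      finally have "(\<Sum>K\<in>snd ` q. Sup K - Inf K) < \<delta>" using U by simp
      moreover have "\<Union>(snd ` q) \<subseteq> {a..b}"
        using K \<open>q \<subseteq> p\<close> by fastforce
      ultimately have small: "(\<Sum>K\<in>snd ` q. norm (f (Sup K) - f (Inf K))) < e / 2 * (b - a)"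
        using \<delta> qdiv by blast
      have "norm (sum T q) \<le> (\<Sum>(x,K)\<in>q. norm (f (Sup K) - f (Inf K)))"
        by (rule sum_norm_le) (auto simp: T_def q_def g_def norm_minus_commute)
      \<comment> \<open>The case distinction makes the summand vanish on every degenerate interval:
        nothing is known about \<open>Sup {}\<close> and \<open>Inf {}\<close>.\<close>
      also have "\<dots> = (\<Sum>(x,K)\<in>q. if K = {} then 0 else norm (f (Sup K) - f (Inf K)))"
        using tagged_partial_division_ofD(2)[OF qpart] by (intro sum.cong) fastforce+
      also have "\<dots> = (\<Sum>K\<in>snd ` q. if K = {} then 0 else norm (f (Sup K) - f (Inf K)))"
      proof (rule sum.over_tagged_division_lemma[OF qtag])
        fix u v :: real assume "box u v = {}"
        then show "(if cbox u v = {} then 0 else norm (f (Sup (cbox u v)) - f (Inf (cbox u v)))) = 0"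
          by (cases u v rule: linorder_cases) simp_all
      qed
      also have "\<dots> = (\<Sum>K\<in>snd ` q. norm (f (Sup K) - f (Inf K)))"
        using qdiv by (intro sum.cong) auto
      finally have bad: "norm (sum T q) \<le> e/2 * (b - a)" using small by simp
      have "(\<Sum>(x, k)\<in>p. measure lborel k *\<^sub>R g x) - (f b - f a) = sum T p"
        by (simp add: ba(2) T_def split_def sum_subtractf)
      also have "\<dots> = sum T (p - q) + sum T q"
        using \<open>finite p\<close> \<open>q \<subseteq> p\<close> by (simp add: sum.subset_diff)
      finally show "norm ((\<Sum>(x, k)\<in>p. measure lborel k *\<^sub>R g x) - (f b - f a)) \<le> e * measure lborel {a..b}"
        using good bad \<open>a < b\<close> norm_triangle_ineq[of "sum T (p - q)" "sum T q"]
        by (simp add: field_simps)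
    qed
  qed
  then show ?thesis
    by (rule has_integral_spike[OF N, rotated]) (simp add: g_def)
qed

text \<open>The definition is applied to the family consisting of the single interval between two
  nearby points.\<close>

lemma abs_continuous_on_imp_continuous_on:
  assumes "abs_continuous_on {a..b} f"
  shows "continuous_on {a..b} f"
  unfolding continuous_on_iff
proof safe
  fix x e :: real
  assume x: "x \<in> {a..b}" and "e > 0"
  obtain \<delta> where "\<delta> > 0" and \<delta>: "\<And>D. \<lbrakk>D division_of \<Union>D; \<Union>D \<subseteq> {a..b}; (\<Sum>K\<in>D. Sup K - Inf K) < \<delta>\<rbrakk>
       \<Longrightarrow> (\<Sum>K\<in>D. norm (f (Sup K) - f (Inf K))) < e"
    using assms \<open>e > 0\<close> unfolding abs_continuous_on_def by meson
  have *: "norm (f v - f u) < e" if "u \<le> v" "{u..v} \<subseteq> {a..b}" "v - u < \<delta>" for u v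
  proof -
    have "{{u..v}} division_of \<Union>{{u..v}}"
      using that division_of_self[of u v] by (simp add: box_real)
    from \<delta>[OF this] show ?thesis using that by simp
  qed
  have "dist (f y) (f x) < e" if "y \<in> {a..b}" "dist y x < \<delta>" for y
    using *[of x y] *[of y x] that x
    by (cases "x \<le> y") (auto simp: dist_norm norm_minus_commute)
  then show "\<exists>d>0. \<forall>x'\<in>{a..b}. dist x' x < d \<longrightarrow> dist (f x') (f x) < e"
    using \<open>\<delta> > 0\<close> by blast
qed

section \<open>Functions of class C^k and Lie derivatives\<close>

text \<open>Riesz representation: \<open>adjoint D 1\<close> is the vector representing the
  functional \<open>D\<close>. This trades the definite description in \<open>gradient\<close> for
  values of a derivative.\<close>

lemma gradient_inner:
  fixes h :: "'a::euclidean_space \<Rightarrow> real"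
  assumes "(h has_derivative D) (at x)"
  shows "gradient h x \<bullet> v = D v"
proof -
  interpret D: bounded_linear D using assms by (rule has_derivative_bounded_linear)
  have D: "D = (\<lambda>v. v \<bullet> adjoint D 1)"
    using adjoint_works[OF D.linear, of _ 1] by (simp add: fun_eq_iff)
  have "GDERIV h x :> adjoint D 1"
    unfolding gderiv_def using assms D by metis
  then have "gradient h x = adjoint D 1" by (rule gradient_eq)
  then show ?thesis using D by (metis inner_commute)
qed

text \<open>Openness matters: functions that agree on an open set agree near each of its points, so
  their Frechet derivatives there coincide and the induction applies to these.\<close>

lemma Ck_on_cong:
  assumes "open S" "Ck_on k S f" "\<And>x. x \<in> S \<Longrightarrow> f x = g x"
  shows "Ck_on k S g"
  using assms(2,3)
proof (induction k arbitrary: f g)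
  case 0
  then show ?case by (auto cong: continuous_on_cong)
next
  case (Suc k)
  have "g differentiable (at x)" if "x \<in> S" for x
    using Suc.prems that \<open>open S\<close> unfolding differentiable_def
    by (metis Ck_on.simps(2) differentiable_def has_derivative_transform_within_open)
  moreover have "frechet_derivative f (at x) = frechet_derivative g (at x)" if "x \<in> S" for x
    using Suc.prems that \<open>open S\<close> by (intro frechet_derivative_transform_within_open) auto
  ultimately show ?case
    using Suc.prems(1) by (auto intro: Suc.IH)
qed

lemma Ck_on_Suc_has_derivative:
  "Ck_on (Suc k) S f \<Longrightarrow> x \<in> S \<Longrightarrow> (f has_derivative frechet_derivative f (at x)) (at x)"
  by (simp add: frechet_derivative_works)

text \<open>Allows the derivative to be supplied by an explicit formula, as the sum and product
  rules do, in place of the choice made by \<open>frechet_derivative\<close>.\<close>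

lemma Ck_on_SucI:
  assumes "open S" and D: "\<And>x. x \<in> S \<Longrightarrow> (f has_derivative D x) (at x)"
    and "\<And>v. Ck_on k S (\<lambda>x. D x v)"
  shows "Ck_on (Suc k) S f"
proof -
  have "Ck_on k S (\<lambda>x. frechet_derivative f (at x) v)" for v
    using assms(1) assms(3)[of v]
  proof (rule Ck_on_cong)
    fix x assume "x \<in> S"
    then show "D x v = frechet_derivative f (at x) v"
      using frechet_derivative_at[OF D] by simp
  qed
  then show ?thesis using D by (auto intro: differentiableI)
qed

lemma Ck_on_imp_continuous_on: "Ck_on k S f \<Longrightarrow> continuous_on S f"
  by (cases k) (auto intro!: continuous_at_imp_continuous_on differentiable_imp_continuous_within)

lemma Ck_on_Suc_imp: "Ck_on (Suc k) S f \<Longrightarrow> Ck_on k S f"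
proof (induction k arbitrary: f)
  case 0
  then show ?case using Ck_on_imp_continuous_on[OF 0] by simp
next
  case (Suc k)
  then show ?case by (metis Ck_on.simps(2))
qed

lemma Ck_on_mono: "Ck_on k S f \<Longrightarrow> j \<le> k \<Longrightarrow> Ck_on j S f"
  by (induction k) (auto simp: le_Suc_eq dest: Ck_on_Suc_imp simp del: Ck_on.simps)

section \<open>Closure of the classes C^k under algebraic operations\<close>

lemma Ck_on_const: "Ck_on k S (\<lambda>x. c)"
  by (induction k arbitrary: c) auto

lemma Ck_on_add:
  assumes "open S" "Ck_on k S f" "Ck_on k S g"
  shows "Ck_on k S (\<lambda>x. f x + g x)"
  using assms(2,3)
proof (induction k arbitrary: f g)
  case 0
  then show ?case by (auto intro: continuous_intros)
next
  case (Suc k)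
  show ?case
  proof (rule Ck_on_SucI[OF \<open>open S\<close>])
    fix x assume "x \<in> S"
    from Suc.prems[THEN Ck_on_Suc_has_derivative, OF this]
    show "((\<lambda>x. f x + g x) has_derivative
      (\<lambda>v. frechet_derivative f (at x) v + frechet_derivative g (at x) v)) (at x)"
      by (rule has_derivative_add)
  next
    show "Ck_on k S (\<lambda>x. frechet_derivative f (at x) v + frechet_derivative g (at x) v)" for v
      using Suc.prems by (intro Suc.IH) auto
  qed
qed

lemma Ck_on_sum:
  assumes "open S" "\<And>i. i \<in> I \<Longrightarrow> Ck_on k S (f i)"
  shows "Ck_on k S (\<lambda>x. \<Sum>i\<in>I. f i x)"
  using assms(2) by (induction I rule: infinite_finite_induct) (auto intro: Ck_on_const Ck_on_add \<open>open S\<close>)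

lemma Ck_on_mult:
  fixes f g :: "'a::euclidean_space \<Rightarrow> 'b::real_normed_algebra"
  assumes "open S" "Ck_on k S f" "Ck_on k S g"
  shows "Ck_on k S (\<lambda>x. f x * g x)"
  using assms(2,3)
proof (induction k arbitrary: f g)
  case 0
  then show ?case by (auto intro: continuous_intros)
next
  case (Suc k)
  show ?case
  proof (rule Ck_on_SucI[OF \<open>open S\<close>])
    fix x assume "x \<in> S"
    from Suc.prems[THEN Ck_on_Suc_has_derivative, OF this]
    show "((\<lambda>x. f x * g x) has_derivative
      (\<lambda>v. f x * frechet_derivative g (at x) v + frechet_derivative f (at x) v * g x)) (at x)"
      by (rule has_derivative_mult)
  next
    show "Ck_on k S (\<lambda>x. f x * frechet_derivative g (at x) v + frechet_derivative f (at x) v * g x)" for v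
      \<comment> \<open>The product rule keeps one factor undifferentiated in each term, so the
        factors themselves are needed at the lower order as well.\<close>
      using Suc.prems Suc.prems[THEN Ck_on_Suc_imp]
      by (intro Ck_on_add[OF \<open>open S\<close>] Suc.IH) auto
  qed
qed

lemma Ck_on_inner_left:
  fixes f :: "'a::euclidean_space \<Rightarrow> 'b::real_inner"
  assumes "open S" "Ck_on k S f"
  shows "Ck_on k S (\<lambda>x. f x \<bullet> c)"
  using assms(2)
proof (induction k arbitrary: f)
  case 0
  then show ?case by (auto intro: continuous_intros)
next
  case (Suc k)
  show ?case
  proof (rule Ck_on_SucI[OF \<open>open S\<close>])
    fix x assume "x \<in> S"
    from Suc.prems[THEN Ck_on_Suc_has_derivative, OF this]
    show "((\<lambda>x. f x \<bullet> c) has_derivative (\<lambda>v. frechet_derivative f (at x) v \<bullet> c)) (at x)"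
      by (rule has_derivative_inner_left)
  next
    show "Ck_on k S (\<lambda>x. frechet_derivative f (at x) v \<bullet> c)" for v
      using Suc by auto
  qed
qed

text \<open>Each Lie derivative consumes one order of smoothness. In coordinates it is a finite sum
  of products of components of \<open>f\<close> with directional derivatives along basis vectors,
  and the closure properties apply.\<close>

lemma Ck_on_lie_deriv:
  assumes "open S" "Ck_on (k + m) S h" "Ck_on (k + m) S f"
  shows "Ck_on k S (lie_deriv m f h)"
  using assms(2,3)
proof (induction m arbitrary: k)
  case 0
  then show ?case by simp
next
  case (Suc m)
  let ?g = "lie_deriv m f h"
  have C: "Ck_on (Suc k) S ?g" using Suc.IH[of "Suc k"] Suc.prems by simp
  have f: "Ck_on k S f"
    using Suc.prems(2) by (rule Ck_on_mono) simp
  have "gradient ?g x \<bullet> f x = (\<Sum>b\<in>Basis. f x \<bullet> b * frechet_derivative ?g (at x) b)" if "x \<in> S" for x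
  proof -
    have D: "(?g has_derivative frechet_derivative ?g (at x)) (at x)"
      using C that by (rule Ck_on_Suc_has_derivative)
    then have "gradient ?g x \<bullet> f x = frechet_derivative ?g (at x) (f x)"
      by (rule gradient_inner)
    also have "\<dots> = (\<Sum>b\<in>Basis. f x \<bullet> b * frechet_derivative ?g (at x) b)"
      using Linear_Algebra.linear_componentwise[OF has_derivative_linear[OF D], of "f x" 1] by simp
    finally show ?thesis .
  qed
  moreover have "Ck_on k S (\<lambda>x. \<Sum>b\<in>Basis. f x \<bullet> b * frechet_derivative ?g (at x) b)"
    using C by (intro Ck_on_sum Ck_on_mult Ck_on_inner_left f \<open>open S\<close>) auto
  ultimately show ?case
    using Ck_on_cong[OF \<open>open S\<close>, of k _ "lie_deriv (Suc m) f h"] by simp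
qed

lemma lie_deriv_along_solution:
  assumes "open S" "Ck_on (Suc m) S h" "Ck_on (Suc m) S f" "\<phi> t \<in> S"
    and "(\<phi> has_vector_derivative f (\<phi> t)) (at t)"
  shows "((\<lambda>t. lie_deriv m f h (\<phi> t)) has_real_derivative lie_deriv (Suc m) f h (\<phi> t)) (at t)"
proof -
  have "Ck_on 1 S (lie_deriv m f h)"
    using assms by (intro Ck_on_lie_deriv) auto
  then have "lie_deriv m f h differentiable (at (\<phi> t))"
    using assms(4) by simp
  then obtain D where D: "(lie_deriv m f h has_derivative D) (at (\<phi> t))"
    by (auto simp: differentiable_def)
  from has_derivative_compose[OF assms(5)[unfolded has_vector_derivative_def] D]
  have "((\<lambda>t. lie_deriv m f h (\<phi> t)) has_derivative (\<lambda>s. D (s *\<^sub>R f (\<phi> t)))) (at t)" .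
  moreover have "D (s *\<^sub>R f (\<phi> t)) = lie_deriv (Suc m) f h (\<phi> t) * s" for s
    using linear_scale[OF has_derivative_linear[OF D]] gradient_inner[OF D] by simp
  ultimately show ?thesis
    by (simp add: has_field_derivative_def)
qed

section \<open>Differential inequalities\<close>

text \<open>By Bolzano-Weierstrass an infinite set of exceptions would accumulate in the compact
  interval. Isolation is assumed at every point of the interval because the limit point may lie
  outside \<open>Z\<close>.\<close>

lemma isolated_exceptions_finite:
  fixes Z :: "real set"
  assumes "\<And>t. t \<in> {a..b} \<Longrightarrow> \<exists>\<delta>>0. \<forall>s\<in>Z. dist s t < \<delta> \<longrightarrow> s = t"
  shows "finite (Z \<inter> {a..b})"
proof (rule ccontr)
  assume "infinite (Z \<inter> {a..b})"
  then obtain t where t: "t \<in> {a..b}" "t islimpt (Z \<inter> {a..b})"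
    using Heine_Borel_imp_Bolzano_Weierstrass[OF compact_Icc, of "Z \<inter> {a..b}" a b] by auto
  then obtain \<delta> where "\<delta> > 0" "\<forall>s\<in>Z. dist s t < \<delta> \<longrightarrow> s = t"
    using assms by blast
  with t(2) show False
    unfolding islimpt_approachable by fastforce
qed

text \<open>The exceptions may accumulate at \<open>a\<close> and \<open>b\<close>, as crossings
  might when a tangency is approached. Compact subintervals of the interior contain finitely many of
  them, so the fundamental theorem of calculus applies there; continuity extends the inequality to
  the endpoints.\<close>

lemma mono_if_deriv_nonneg_off_isolated:
  fixes g :: "real \<Rightarrow> real"
  assumes "a < b" and cont: "continuous_on {a..b} g"
    and Z: "\<And>t. t \<in> {a<..<b} \<Longrightarrow> \<exists>\<delta>>0. \<forall>s\<in>Z. dist s t < \<delta> \<longrightarrow> s = t"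
    and deriv: "\<And>t. t \<in> {a<..<b} - Z \<Longrightarrow> (g has_real_derivative g' t) (at t)"
    and nonneg: "\<And>t. t \<in> {a<..<b} - Z \<Longrightarrow> g' t \<ge> 0"
  shows "g a \<le> g b"
proof -
  have inner: "g c \<le> g d" if "a < c" "c \<le> d" "d < b" for c d
  proof -
    have fin: "finite (Z \<inter> {c..d})"
      using that by (intro isolated_exceptions_finite Z) auto
    \<comment> \<open>The value 0 on \<open>Z\<close> makes the integrand nonnegative at the
      exceptional times too, where nothing is known about \<open>g'\<close>.\<close>
    define k where "k t = (if t \<in> Z then 0 else g' t)" for t
    have "(k has_integral (g d - g c)) {c..d}"
    proof (rule fundamental_theorem_of_calculus_interior_strong[OF fin \<open>c \<le> d\<close>])
      fix t assume "t \<in> {c<..<d} - Z \<inter> {c..d}"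
      then have "t \<in> {a<..<b} - Z" using that by auto
      from deriv[OF this] this show "(g has_vector_derivative k t) (at t)"
        by (simp add: k_def has_real_derivative_iff_has_vector_derivative)
    qed (rule continuous_on_subset[OF cont], use that in auto)
    moreover have "0 \<le> k t" if "t \<in> {c..d}" for t
      using nonneg[of t] that \<open>a < c\<close> \<open>d < b\<close> by (auto simp: k_def)
    ultimately have "0 \<le> g d - g c"
      by (rule has_integral_nonneg)
    then show ?thesis by simp
  qed
  \<comment> \<open>The midpoint allows each endpoint to be treated separately: on each half the
    inequality passes from the open interval to its closure.\<close>
  define c where "c = (a + b) / 2"
  have c: "a < c" "c < b" using \<open>a < b\<close> by (auto simp: c_def)
  have "g a \<le> g c"
  proof (rule continuous_le_on_closure[where f = g and x = a])
    show "continuous_on (closure {a<..<c}) g" "a \<in> closure {a<..<c}"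
      using c by (auto intro: continuous_on_subset[OF cont])
  qed (use c inner in auto)
  also have "g c \<le> g b"
  proof (rule continuous_ge_on_closure[where f = g and x = b])
    show "continuous_on (closure {c<..<b}) g" "b \<in> closure {c<..<b}"
      using c by (auto intro: continuous_on_subset[OF cont])
  qed (use c inner in auto)
  finally show ?thesis .
qed

text \<open>Gronwall in both time directions: the bound makes \<open>exp (C * t) * g t\<close>
  nondecreasing and \<open>exp (- C * t) * g t\<close> nonincreasing. The first rules out a positive
  \<open>g\<close> reaching 0 at the right end, the second at the left end.\<close>

lemma exponential_bounds:
  fixes g :: "real \<Rightarrow> real"
  assumes "a < b" and cont: "continuous_on {a..b} g"
    and Z: "\<And>t. t \<in> {a<..<b} \<Longrightarrow> \<exists>\<delta>>0. \<forall>s\<in>Z. dist s t < \<delta> \<longrightarrow> s = t"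
    and deriv: "\<And>t. t \<in> {a<..<b} - Z \<Longrightarrow> (g has_real_derivative g' t) (at t)"
    and bound: "\<And>t. t \<in> {a<..<b} - Z \<Longrightarrow> \<bar>g' t\<bar> \<le> C * g t"
  shows "exp (C * a) * g a \<le> exp (C * b) * g b"
    and "exp (- C * b) * g b \<le> exp (- C * a) * g a"
proof -
  show "exp (C * a) * g a \<le> exp (C * b) * g b"
  proof (rule mono_if_deriv_nonneg_off_isolated[OF \<open>a < b\<close> _ Z])
    fix t assume t: "t \<in> {a<..<b} - Z"
    show "((\<lambda>t. exp (C * t) * g t) has_real_derivative exp (C * t) * (C * g t + g' t)) (at t)"
      by (rule derivative_eq_intros deriv[OF t] refl | simp add: algebra_simps)+
    show "exp (C * t) * (C * g t + g' t) \<ge> 0"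
      using bound[OF t] by (intro mult_nonneg_nonneg) auto
  qed (auto intro!: continuous_intros cont)
  have "- (exp (- C * a) * g a) \<le> - (exp (- C * b) * g b)"
  proof (rule mono_if_deriv_nonneg_off_isolated[OF \<open>a < b\<close> _ Z])
    fix t assume t: "t \<in> {a<..<b} - Z"
    show "((\<lambda>t. - (exp (- C * t) * g t)) has_real_derivative exp (- C * t) * (C * g t - g' t)) (at t)"
      by (rule derivative_eq_intros deriv[OF t] refl | simp add: algebra_simps)+
    show "exp (- C * t) * (C * g t - g' t) \<ge> 0"
      using bound[OF t] by (intro mult_nonneg_nonneg) auto
  qed (auto intro!: continuous_intros cont)
  then show "exp (- C * b) * g b \<le> exp (- C * a) * g a" by simp
qed

section \<open>Filippov solutions\<close>

lemma filippov_set_nonempty: "filippov_set fL fR H x \<noteq> {}"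
  by (auto simp: filippov_set_def intro!: exI[of _ 0])

text \<open>Transfers convex constraints on the two fields to every admissible velocity, including
  the convex combinations on the switching surface.\<close>

lemma filippov_set_subset_convex:
  assumes "convex C" "fL x \<in> C" "fR x \<in> C"
  shows "filippov_set fL fR H x \<subseteq> C"
  using assms by (auto simp: filippov_set_def convex_alt)

text \<open>Replaces the differential inclusion by an integral equation: one selected velocity
  serves all compact subintervals of \<open>I\<close>, so that bounds on the Filippov set can be
  integrated.\<close>

lemma filippov_solution_has_integral:
  fixes \<phi> :: "real \<Rightarrow> 'a::euclidean_space"
  assumes sol: "filippov_solution \<Omega> fL fR H I \<phi>"
  obtains v where "\<And>t. v t \<in> filippov_set fL fR H (\<phi> t)"
    and "\<And>a b. a \<le> b \<Longrightarrow> {a..b} \<subseteq> I \<Longrightarrow> (v has_integral \<phi> b - \<phi> a) {a..b}"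
proof -
  let ?P = "\<lambda>t v. v \<in> filippov_set fL fR H (\<phi> t)
    \<and> (\<phi> has_vector_derivative v) (at t within I)"
  have "AE t in lborel. t \<in> I \<longrightarrow> (\<exists>v. ?P t v)"
    using sol unfolding filippov_solution_def Bex_def by blast
  then obtain N where N: "\<And>t. t \<in> space lborel - N \<Longrightarrow> t \<in> I \<longrightarrow> (\<exists>v. ?P t v)" "N \<in> null_sets lborel"
    by (rule AE_E3) (rule that)
  \<comment> \<open>At exceptional times, and outside \<open>I\<close>, any element of the Filippov
    set is taken, so that membership holds for every \<open>t\<close> and not just almost
    everywhere.\<close>
  define v where "v t = (if t \<in> I - N then SOME v. ?P t v else SOME v. v \<in> filippov_set fL fR H (\<phi> t))" for t
  have P: "?P t (v t)" if "t \<in> I - N" for t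
    using that N(1)[of t] someI_ex[of "?P t"] by (simp add: v_def)
  show thesis
  proof
    show "v t \<in> filippov_set fL fR H (\<phi> t)" for t
      using P[of t] filippov_set_nonempty[of fL fR H "\<phi> t"] some_in_eq[of "filippov_set fL fR H (\<phi> t)"]
      by (cases "t \<in> I - N") (auto simp: v_def)
    show "(v has_integral \<phi> b - \<phi> a) {a..b}" if "a \<le> b" "{a..b} \<subseteq> I" for a b
    proof (rule abs_continuous_on_fundamental_theorem[OF that(1)])
      show "abs_continuous_on {a..b} \<phi>"
        using sol that by (auto simp: filippov_solution_def)
      show "negligible N"
        using N(2) by (simp add: negligible_iff_null_sets null_sets_completionI)
      show "(\<phi> has_vector_derivative v t) (at t within {a..b})" if "t \<in> {a..b} - N" for t
        using P[of t] that \<open>{a..b} \<subseteq> I\<close> has_vector_derivative_within_subset by blast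
    qed
  qed
qed

lemma filippov_solution_continuous_on:
  "filippov_solution \<Omega> fL fR H I \<phi> \<Longrightarrow> {a..b} \<subseteq> I \<Longrightarrow> continuous_on {a..b} \<phi>"
  by (auto simp: filippov_solution_def intro: abs_continuous_on_imp_continuous_on)

text \<open>Where the inclusion is single-valued and continuous, the integrand of the integral
  equation is continuous. Hence the solution is differentiable at every time there, not only at
  almost every time.\<close>

lemma filippov_solution_has_vector_derivative:
  fixes \<phi> :: "real \<Rightarrow> 'a::euclidean_space"
  assumes sol: "filippov_solution \<Omega> fL fR H I \<phi>" and I: "{a..b} \<subseteq> I"
    and t: "t \<in> {a<..<b}" and W: "open W" "\<phi> t \<in> W"
    and f: "continuous_on W f" "\<And>y. y \<in> W \<Longrightarrow> filippov_set fL fR H y = {f y}"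
  shows "(\<phi> has_vector_derivative f (\<phi> t)) (at t)"
proof -
  have "continuous_on {a<..<b} \<phi>"
    using filippov_solution_continuous_on[OF sol I] continuous_on_subset greaterThanLessThan_subseteq_atLeastAtMost_iff
    by blast
  then have "open (\<phi> -` W \<inter> {a<..<b})"
    using W(1) continuous_on_open_vimage[of "{a<..<b}" \<phi>] by auto
  then obtain r where "r > 0" and r: "cball t r \<subseteq> \<phi> -` W \<inter> {a<..<b}"
    using t W(2) open_contains_cball by blast
  define c d where "c = t - r" "d = t + r"
  have cd: "c < t" "t < d" "{c..d} \<subseteq> {a..b}" "\<And>s. s \<in> {c..d} \<Longrightarrow> \<phi> s \<in> W"
    using \<open>r > 0\<close> r r[THEN subsetD, of c] r[THEN subsetD, of d]
    by (auto simp: c_d_def cball_eq_atLeastAtMost)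
  obtain v where v: "\<And>t. v t \<in> filippov_set fL fR H (\<phi> t)"
    "\<And>a b. a \<le> b \<Longrightarrow> {a..b} \<subseteq> I \<Longrightarrow> (v has_integral \<phi> b - \<phi> a) {a..b}"
    using filippov_solution_has_integral[OF sol] by blast
  let ?g = "\<lambda>s. f (\<phi> s)"
  have vf: "v s = ?g s" if "s \<in> {c..d}" for s
    using v(1)[of s] f(2)[OF cd(4)[OF that]] by simp
  have \<phi>: "\<phi> u = \<phi> c + integral {c..u} ?g" if "u \<in> {c..d}" for u
  proof -
    have "(?g has_integral \<phi> u - \<phi> c) {c..u}"
    proof (rule has_integral_eq)
      show "(v has_integral \<phi> u - \<phi> c) {c..u}"
      proof (rule v(2))
        show "c \<le> u" using that by simp
        have "{c..u} \<subseteq> {c..d}" using that by auto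
        then show "{c..u} \<subseteq> I" using cd(3) I by blast
      qed
    qed (use vf that in auto)
    then show ?thesis by (simp add: integral_unique)
  qed
  have "continuous_on {c..d} ?g"
  proof (rule continuous_on_compose2[OF f(1)])
    show "continuous_on {c..d} \<phi>"
      using filippov_solution_continuous_on[OF sol I] cd(3) by (rule continuous_on_subset)
  qed (use cd(4) in blast)
  then have "((\<lambda>u. integral {c..u} ?g) has_vector_derivative ?g t) (at t within {c..d})"
    using cd by (intro integral_has_vector_derivative) auto
  then have "((\<lambda>u. \<phi> c + integral {c..u} ?g) has_vector_derivative ?g t) (at t within {c..d})"
    using has_vector_derivative_const has_vector_derivative_add by fastforce
  from has_vector_derivative_transform[OF _ \<phi> this]
  have "(\<phi> has_vector_derivative ?g t) (at t within {c..d})"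
    using cd by simp
  then show ?thesis
    using cd by (simp add: at_within_Icc_at)
qed

text \<open>Near a crossing point all admissible velocities have \<open>D\<close>-component close to \<open>w \<noteq> 0\<close>.\<close>

lemma filippov_solution_isolated_crossing:
  fixes \<phi> :: "real \<Rightarrow> 'a::euclidean_space"
  assumes sol: "filippov_solution \<Omega> fL fR H I \<phi>" and I: "{a..b} \<subseteq> I"
    and t0: "t0 \<in> {a..b}" "H (\<phi> t0) = 0"
    and f: "isCont fL (\<phi> t0)" "isCont fR (\<phi> t0)"
    and D: "(H has_derivative D) (at (\<phi> t0))" "D (fL (\<phi> t0)) = w" "D (fR (\<phi> t0)) = w" "w \<noteq> 0"
  shows "\<exists>\<delta>>0. \<forall>t\<in>{a..b}. H (\<phi> t) = 0 \<longrightarrow> dist t t0 < \<delta> \<longrightarrow> t = t0"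
proof -
  define p where "p = \<phi> t0"
  interpret D: bounded_linear D using D(1) by (rule has_derivative_bounded_linear)
  define M where "M = norm (fL p) + norm (fR p) + 1"
  have M: "M > 0" "norm (fL p) < M" "norm (fR p) < M"
    unfolding M_def by (smt (verit) norm_ge_zero)+
  \<comment> \<open>Velocities of norm at most \<open>M\<close> whose \<open>D\<close>-component is
    within \<open>\<bar>w\<bar>/2\<close> of \<open>w\<close>. Convexity is what passes these bounds
    from the two fields to the Filippov set.\<close>
  define C where "C = cball 0 M \<inter> D -` cball w (\<bar>w\<bar>/2)"
  have "convex C"
    unfolding C_def using D.linear by (intro convex_Int convex_linear_vimage) auto
  have ev: "eventually (\<lambda>y. f y \<in> C) (nhds p)" if "isCont f p" "D (f p) = w" "norm (f p) < M" for f
  proof -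
    have f: "(f \<longlongrightarrow> f p) (nhds p)" using that(1) by (simp add: continuous_at tendsto_nhds_iff)
    have "eventually (\<lambda>y. norm (f y) < M) (nhds p)"
      using tendsto_norm[OF f] that(3) by (rule order_tendstoD)
    moreover have "eventually (\<lambda>y. dist (D (f y)) (D (f p)) < \<bar>w\<bar>/2) (nhds p)"
      using D.tendsto[OF f] D(4) by (intro tendstoD) auto
    ultimately show ?thesis
      by eventually_elim (use that(2) in \<open>auto simp: C_def dist_commute\<close>)
  qed
  \<comment> \<open>The factor \<open>1/(4*M)\<close> is chosen so that, at speed at most
    \<open>M\<close>, the linearization error is at most
    \<open>\<bar>w\<bar>/4 * \<bar>t - t0\<bar>\<close>, which is less than the guaranteed drift
    \<open>\<bar>w\<bar>/2 * \<bar>t - t0\<bar>\<close>.\<close>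
  have H: "eventually (\<lambda>y. \<bar>H y - H p - D (y - p)\<bar> \<le> \<bar>w\<bar>/(4*M) * norm (y - p)) (nhds p)"
  proof -
    have "\<bar>w\<bar>/(4*M) > 0" using M(1) D(4) by simp
    then show ?thesis
      using D(1) unfolding p_def[symmetric] has_derivative_at_alt eventually_nhds_metric dist_norm real_norm_def
      by blast
  qed
  have "eventually (\<lambda>y. fL y \<in> C \<and> fR y \<in> C \<and> \<bar>H y - H p - D (y - p)\<bar> \<le> \<bar>w\<bar>/(4*M) * norm (y - p)) (nhds p)"
    using f D M ev[of fL] ev[of fR] H by (auto simp: p_def intro: eventually_conj)
  then obtain r where "r > 0" and r: "\<And>y. dist y p < r \<Longrightarrow>
      fL y \<in> C \<and> fR y \<in> C \<and> \<bar>H y - H p - D (y - p)\<bar> \<le> \<bar>w\<bar>/(4*M) * norm (y - p)"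
    unfolding eventually_nhds_metric by blast
  obtain \<delta> where "\<delta> > 0" and \<delta>: "\<And>t. t \<in> {a..b} \<Longrightarrow> dist t t0 < \<delta> \<Longrightarrow> dist (\<phi> t) p < r"
    using filippov_solution_continuous_on[OF sol I] t0(1) \<open>r > 0\<close> unfolding continuous_on_iff p_def by blast
  obtain v where v: "\<And>t. v t \<in> filippov_set fL fR H (\<phi> t)"
    "\<And>a b. a \<le> b \<Longrightarrow> {a..b} \<subseteq> I \<Longrightarrow> (v has_integral \<phi> b - \<phi> a) {a..b}"
    using filippov_solution_has_integral[OF sol] by blast
  have incr: "norm (\<phi> d - \<phi> c) \<le> M * (d - c)" "\<bar>D (\<phi> d - \<phi> c) - w * (d - c)\<bar> \<le> \<bar>w\<bar>/2 * (d - c)"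
    if "c \<le> d" "{c..d} \<subseteq> {a..b}" "\<And>t. t \<in> {c..d} \<Longrightarrow> dist t t0 < \<delta>" for c d
  proof -
    have vC: "v t \<in> C" if "t \<in> {c..d}" for t
      using filippov_set_subset_convex[OF \<open>convex C\<close>] r[OF \<delta>] v(1)[of t] that
        \<open>{c..d} \<subseteq> {a..b}\<close> \<open>\<And>t. t \<in> {c..d} \<Longrightarrow> dist t t0 < \<delta>\<close> by blast
    have int: "(v has_integral \<phi> d - \<phi> c) {c..d}"
      using v(2)[of c d] that(1,2) I by blast
    show "norm (\<phi> d - \<phi> c) \<le> M * (d - c)"
      using has_integral_bound_real[OF _ finite.emptyI int, of M] vC M(1) \<open>c \<le> d\<close> by (auto simp: C_def)
    have "((\<lambda>t. D (v t) - w) has_integral D (\<phi> d - \<phi> c) - w * (d - c)) {c..d}"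
      using has_integral_diff[OF has_integral_linear[OF int D.bounded_linear] has_integral_const_real[of w c d]]
        \<open>c \<le> d\<close> by (simp add: o_def mult.commute)
    from has_integral_bound_real[OF _ finite.emptyI this, of "\<bar>w\<bar>/2"]
    show "\<bar>D (\<phi> d - \<phi> c) - w * (d - c)\<bar> \<le> \<bar>w\<bar>/2 * (d - c)"
      using vC \<open>c \<le> d\<close> by (auto simp: C_def dist_real_def abs_minus_commute)
  qed
  have "t = t0" if t: "t \<in> {a..b}" "H (\<phi> t) = 0" "dist t t0 < \<delta>" for t
  proof (rule ccontr)
    assume "t \<noteq> t0"
    have "norm (\<phi> t - p) \<le> M * \<bar>t - t0\<bar> \<and> \<bar>D (\<phi> t - p) - w * (t - t0)\<bar> \<le> \<bar>w\<bar>/2 * \<bar>t - t0\<bar>"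
    proof (cases "t0 \<le> t")
      case True
      then show ?thesis using incr[of t0 t] t t0 by (auto simp: p_def dist_real_def)
    next
      case False
      then have "norm (\<phi> t0 - \<phi> t) \<le> M * (t0 - t)" "\<bar>D (\<phi> t0 - \<phi> t) - w * (t0 - t)\<bar> \<le> \<bar>w\<bar>/2 * (t0 - t)"
        using incr[of t t0] t t0 by (auto simp: dist_real_def)
      then show ?thesis
        using False by (simp add: p_def norm_minus_commute D.diff abs_minus_commute algebra_simps)
    qed
    then have 1: "norm (\<phi> t - p) \<le> M * \<bar>t - t0\<bar>" and "\<bar>D (\<phi> t - p) - w * (t - t0)\<bar> \<le> \<bar>w\<bar>/2 * \<bar>t - t0\<bar>"
      by auto
    \<comment> \<open>Since \<open>H\<close> vanishes at both times, \<open>D (\<phi> t - p)\<close>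
      is pure linearization error. The right-hand side is then at most three quarters of the left,
      which is absurd.\<close>
    then have "\<bar>w\<bar> * \<bar>t - t0\<bar> \<le> \<bar>w\<bar>/2 * \<bar>t - t0\<bar> + \<bar>D (\<phi> t - p)\<bar>"
      unfolding abs_mult[symmetric] by linarith
    moreover have "\<bar>D (\<phi> t - p)\<bar> \<le> \<bar>w\<bar>/(4*M) * norm (\<phi> t - p)"
      using r[OF \<delta>[OF t(1,3)]] t(2) t0(2) by (auto simp: p_def)
    moreover have "\<bar>w\<bar>/(4*M) * norm (\<phi> t - p) \<le> \<bar>w\<bar>/(4*M) * (M * \<bar>t - t0\<bar>)"
      using 1 M(1) by (intro mult_left_mono) auto
    moreover have "\<bar>w\<bar>/(4*M) * (M * \<bar>t - t0\<bar>) = \<bar>w\<bar>/4 * \<bar>t - t0\<bar>"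
      using M(1) by simp
    moreover have "\<bar>w\<bar> * \<bar>t - t0\<bar> > 0"
      using D(4) \<open>t \<noteq> t0\<close> by simp
    ultimately show False by (simp add: field_simps)
  qed
  then show ?thesis using \<open>\<delta> > 0\<close> by blast
qed

section \<open>The tangency energy\<close>

text \<open>With \<open>h t = H (\<phi> t)\<close> along an orbit of the active field, this is
  \<open>h'^2 / 2 - h * h''\<close>: the mechanical energy of a particle at height \<open>h\<close>
  under the force \<open>h''\<close>, conserved if that force were constant.\<close>

definition tangency_energy ::
  "('a::euclidean_space \<Rightarrow> 'a) \<Rightarrow> ('a \<Rightarrow> 'a) \<Rightarrow> ('a \<Rightarrow> real) \<Rightarrow> 'a \<Rightarrow> real" where
  "tangency_energy fL fR H x =
     (if H x \<le> 0 then (lie_deriv 1 fL H x)\<^sup>2 / 2 - H x * lie_deriv 2 fL H x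
      else (lie_deriv 1 fR H x)\<^sup>2 / 2 - H x * lie_deriv 2 fR H x)"

lemma lie_deriv_continuous_on:
  assumes "open \<Omega>" "Ck_on k \<Omega> f" "Ck_on (k + 1) \<Omega> H" "m \<le> k"
  shows "continuous_on \<Omega> (lie_deriv m f H)"
proof -
  have "Ck_on (k - m + m) \<Omega> H" "Ck_on (k - m + m) \<Omega> f"
    using assms(2-4) Ck_on_Suc_imp[of k \<Omega> H] by (simp_all del: Ck_on.simps)
  then show ?thesis
    using Ck_on_lie_deriv[OF assms(1)] Ck_on_imp_continuous_on by blast
qed

text \<open>Where the two branches meet, the terms with factor \<open>H\<close> vanish and the
  squares agree by refraction.\<close>

lemma tangency_energy_continuous_on:
  assumes pw: "piecewise_Ck 3 \<Omega> fL fR H" and refr: "refracting \<Omega> fL fR H"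
  shows "continuous_on \<Omega> (tangency_energy fL fR H)"
proof -
  have \<Omega>: "open \<Omega>" and C: "Ck_on 3 \<Omega> fL" "Ck_on 3 \<Omega> fR" "Ck_on (3 + 1) \<Omega> H"
    using pw by (auto simp: piecewise_Ck_def simp del: Ck_on.simps)
  have cont: "continuous_on \<Omega> H"
    "continuous_on \<Omega> (lie_deriv 1 fL H)" "continuous_on \<Omega> (lie_deriv 2 fL H)"
    "continuous_on \<Omega> (lie_deriv 1 fR H)" "continuous_on \<Omega> (lie_deriv 2 fR H)"
    using lie_deriv_continuous_on[OF \<Omega> C(1,3)] lie_deriv_continuous_on[OF \<Omega> C(2,3)]
      Ck_on_imp_continuous_on[OF C(3)] by (simp_all del: lie_deriv.simps)
  show ?thesis
    unfolding tangency_energy_def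
  proof (rule continuous_on_cases_le)
    show "continuous_on {x \<in> \<Omega>. H x \<le> 0} (\<lambda>x. (lie_deriv 1 fL H x)\<^sup>2 / 2 - H x * lie_deriv 2 fL H x)"
      using cont(1,2,3)[THEN continuous_on_subset, of "{x \<in> \<Omega>. H x \<le> 0}"]
      by (auto intro!: continuous_intros simp del: lie_deriv.simps)
    show "continuous_on {x \<in> \<Omega>. 0 \<le> H x} (\<lambda>x. (lie_deriv 1 fR H x)\<^sup>2 / 2 - H x * lie_deriv 2 fR H x)"
      using cont(1,4,5)[THEN continuous_on_subset, of "{x \<in> \<Omega>. 0 \<le> H x}"]
      by (auto intro!: continuous_intros simp del: lie_deriv.simps)
  qed (use cont refr in \<open>auto simp: refracting_def switching_surface_def simp del: lie_deriv.simps\<close>)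
qed

text \<open>The two terms \<open>L\<^sub>f H \<cdot> L\<^sub>f\<^sup>2 H\<close> cancel, so the derivative has the factor \<open>H\<close>, and
  \<open>\<bar>H\<bar>\<close> is controlled by the energy wherever \<open>- H \<cdot> L\<^sub>f\<^sup>2 H > 0\<close>.\<close>

lemma half_energy_along_solution:
  assumes "open S" "Ck_on 3 S H" "Ck_on 3 S f" "\<phi> t \<in> S"
    and "(\<phi> has_vector_derivative f (\<phi> t)) (at t)"
  shows "((\<lambda>t. (lie_deriv 1 f H (\<phi> t))\<^sup>2 / 2 - H (\<phi> t) * lie_deriv 2 f H (\<phi> t)) has_real_derivative
    - H (\<phi> t) * lie_deriv 3 f H (\<phi> t)) (at t)"
proof -
  have C: "Ck_on (Suc m) S H" "Ck_on (Suc m) S f" if "m \<le> 2" for m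
    using that by (auto intro: Ck_on_mono[OF assms(2)] Ck_on_mono[OF assms(3)] simp del: Ck_on.simps)
  have D: "((\<lambda>t. lie_deriv m f H (\<phi> t)) has_real_derivative lie_deriv (Suc m) f H (\<phi> t)) (at t)" if "m \<le> 2" for m
    using lie_deriv_along_solution[OF assms(1) C[OF that] assms(4,5)] .
  have "(H \<circ> \<phi> has_real_derivative lie_deriv 1 f H (\<phi> t)) (at t)"
    "((\<lambda>t. lie_deriv 1 f H (\<phi> t)) has_real_derivative lie_deriv 2 f H (\<phi> t)) (at t)"
    "((\<lambda>t. lie_deriv 2 f H (\<phi> t)) has_real_derivative lie_deriv 3 f H (\<phi> t)) (at t)"
    using D[of 0] D[of 1] D[of 2]
    by (simp_all only: numeral_2_eq_2 numeral_3_eq_3 One_nat_def o_def lie_deriv.simps(1))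
  note D = this[unfolded o_def]
  show ?thesis
    by (rule derivative_eq_intros D refl | simp add: algebra_simps del: lie_deriv.simps)+
qed

text \<open>Strict inequalities between continuous functions persist near \<open>p\<close>. Class
  C^3 enters here through the continuity of the third Lie derivatives, and \<open>C\<close> becomes
  the Gronwall constant.\<close>

lemma invisible_invisible_neighbourhood:
  assumes pw: "piecewise_Ck 3 \<Omega> fL fR H" and p: "p \<in> \<Omega>"
    and inv: "lie_deriv 2 fL H p > 0" "lie_deriv 2 fR H p < 0"
  obtains B C where "C \<ge> 0" "open B" "p \<in> B" "B \<subseteq> \<Omega>"
    "\<And>x. x \<in> B \<Longrightarrow> lie_deriv 2 fL H x > 0"
    "\<And>x. x \<in> B \<Longrightarrow> lie_deriv 2 fR H x < 0"
    "\<And>x. x \<in> B \<Longrightarrow> \<bar>lie_deriv 3 fL H x\<bar> \<le> C * lie_deriv 2 fL H x"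
    "\<And>x. x \<in> B \<Longrightarrow> \<bar>lie_deriv 3 fR H x\<bar> \<le> - C * lie_deriv 2 fR H x"
proof -
  have \<Omega>: "open \<Omega>" and Ck: "Ck_on 3 \<Omega> fL" "Ck_on 3 \<Omega> fR" "Ck_on (3 + 1) \<Omega> H"
    using pw by (auto simp: piecewise_Ck_def simp del: Ck_on.simps)
  have tend: "((\<lambda>x. lie_deriv m f H x) \<longlongrightarrow> lie_deriv m f H p) (nhds p)"
    if "m \<le> 3" "f = fL \<or> f = fR" for m f
  proof -
    have "continuous_on \<Omega> (lie_deriv m f H)"
      using that lie_deriv_continuous_on[OF \<Omega> _ Ck(3)] Ck(1,2) by blast
    then show ?thesis
      using \<Omega> p by (simp add: continuous_on_eq_continuous_at continuous_at tendsto_nhds_iff)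
  qed
  \<comment> \<open>Both ratios are nonnegative, so their sum plus 1 strictly exceeds each of them;
    strictness is what survives in a neighbourhood.\<close>
  define C where "C = \<bar>lie_deriv 3 fL H p\<bar> / lie_deriv 2 fL H p
      + \<bar>lie_deriv 3 fR H p\<bar> / - lie_deriv 2 fR H p + 1"
  have CL: "\<bar>lie_deriv 3 fL H p\<bar> < C * lie_deriv 2 fL H p"
  proof -
    have "\<bar>lie_deriv 3 fR H p\<bar> / - lie_deriv 2 fR H p \<ge> 0"
      using inv by (intro divide_nonneg_pos) auto
    then have "\<bar>lie_deriv 3 fL H p\<bar> / lie_deriv 2 fL H p < C"
      by (simp add: C_def del: lie_deriv.simps)
    then show ?thesis using inv by (simp add: pos_divide_less_eq del: lie_deriv.simps)
  qed
  have CR: "\<bar>lie_deriv 3 fR H p\<bar> < C * - lie_deriv 2 fR H p"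
  proof -
    have "\<bar>lie_deriv 3 fL H p\<bar> / lie_deriv 2 fL H p \<ge> 0"
      using inv by (intro divide_nonneg_pos) auto
    then have *: "\<bar>lie_deriv 3 fR H p\<bar> / - lie_deriv 2 fR H p < C"
      by (simp add: C_def del: lie_deriv.simps)
    have "- lie_deriv 2 fR H p > 0" using inv by simp
    from * show ?thesis unfolding pos_divide_less_eq[OF \<open>- lie_deriv 2 fR H p > 0\<close>] .
  qed
  have "eventually (\<lambda>x. 0 < C * lie_deriv 2 fL H x - \<bar>lie_deriv 3 fL H x\<bar>) (nhds p)"
    by (rule order_tendstoD(1)[of _ "C * lie_deriv 2 fL H p - \<bar>lie_deriv 3 fL H p\<bar>"])
      (use CL in \<open>auto intro!: tendsto_intros tend simp del: lie_deriv.simps\<close>)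
  moreover have "eventually (\<lambda>x. 0 < C * - lie_deriv 2 fR H x - \<bar>lie_deriv 3 fR H x\<bar>) (nhds p)"
    by (rule order_tendstoD(1)[of _ "C * - lie_deriv 2 fR H p - \<bar>lie_deriv 3 fR H p\<bar>"])
      (use CR in \<open>auto intro!: tendsto_intros tend simp del: lie_deriv.simps\<close>)
  moreover have "eventually (\<lambda>x. 0 < lie_deriv 2 fL H x) (nhds p)"
    using order_tendstoD(1)[OF tend inv(1)] by simp
  moreover have "eventually (\<lambda>x. lie_deriv 2 fR H x < 0) (nhds p)"
    using order_tendstoD(2)[OF tend inv(2)] by simp
  moreover have "eventually (\<lambda>x. x \<in> \<Omega>) (nhds p)"
    using \<Omega> p by (rule eventually_nhds_in_open)
  ultimately have "eventually (\<lambda>x. 0 < C * lie_deriv 2 fL H x - \<bar>lie_deriv 3 fL H x\<bar>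
      \<and> 0 < C * - lie_deriv 2 fR H x - \<bar>lie_deriv 3 fR H x\<bar>
      \<and> 0 < lie_deriv 2 fL H x \<and> lie_deriv 2 fR H x < 0 \<and> x \<in> \<Omega>) (nhds p)"
    by (intro eventually_conj)
  then obtain B where "open B" "p \<in> B" and B: "\<And>x. x \<in> B \<Longrightarrow>
      0 < C * lie_deriv 2 fL H x - \<bar>lie_deriv 3 fL H x\<bar>
      \<and> 0 < C * - lie_deriv 2 fR H x - \<bar>lie_deriv 3 fR H x\<bar>
      \<and> 0 < lie_deriv 2 fL H x \<and> lie_deriv 2 fR H x < 0 \<and> x \<in> \<Omega>"
    unfolding eventually_nhds by blast
  show thesis
  proof
    have "C * lie_deriv 2 fL H p > 0" using CL by linarith
    then show "C \<ge> 0" using inv(1) by (simp add: zero_less_mult_iff del: lie_deriv.simps)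
    show "B \<subseteq> \<Omega>" using B by blast
    fix x assume "x \<in> B"
    note B[OF this]
    then show "lie_deriv 2 fL H x > 0" "lie_deriv 2 fR H x < 0"
      "\<bar>lie_deriv 3 fL H x\<bar> \<le> C * lie_deriv 2 fL H x"
      "\<bar>lie_deriv 3 fR H x\<bar> \<le> - C * lie_deriv 2 fR H x"
      by (auto simp del: lie_deriv.simps)
  qed fact+
qed

text \<open>Off the switching surface, \<open>H\<close> and the second Lie derivative of the active
  field have opposite signs. On it, the square is positive because the point is not a
  tangency.\<close>

lemma tangency_energy_pos:
  assumes "refracting \<Omega> fL fR H" "x \<in> \<Omega>" "x \<notin> tangency_surface \<Omega> fL H"
    and "lie_deriv 2 fL H x > 0" "lie_deriv 2 fR H x < 0"
  shows "tangency_energy fL fR H x > 0"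
proof (cases "H x" "0 :: real" rule: linorder_cases)
  case less
  then have "H x * lie_deriv 2 fL H x < 0"
    using assms(4) by (rule mult_neg_pos)
  moreover have "(lie_deriv 1 fL H x)\<^sup>2 / 2 \<ge> 0" by simp
  moreover have "tangency_energy fL fR H x = (lie_deriv 1 fL H x)\<^sup>2 / 2 - H x * lie_deriv 2 fL H x"
    using less by (simp add: tangency_energy_def)
  ultimately show ?thesis by linarith
next
  case equal
  then have "lie_deriv 1 fL H x \<noteq> 0"
    using assms(2,3) by (auto simp: tangency_surface_def switching_surface_def simp del: lie_deriv.simps)
  with equal show ?thesis by (simp add: tangency_energy_def del: lie_deriv.simps)
next
  case greater
  then have "H x * lie_deriv 2 fR H x < 0"
    using assms(5) by (rule mult_pos_neg)
  moreover have "(lie_deriv 1 fR H x)\<^sup>2 / 2 \<ge> 0" by simp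
  moreover have "tangency_energy fL fR H x = (lie_deriv 1 fR H x)\<^sup>2 / 2 - H x * lie_deriv 2 fR H x"
    using greater by (simp add: tangency_energy_def)
  ultimately show ?thesis by linarith
qed

lemma tangency_energy_eq_0:
  "x \<in> tangency_surface \<Omega> fL H \<Longrightarrow> tangency_energy fL fR H x = 0"
  by (simp add: tangency_energy_def tangency_surface_def switching_surface_def del: lie_deriv.simps)

text \<open>Gronwall for the energy along a solution. The neighbourhood and non-tangency conditions
  concern only the open interval, so that an endpoint may be the tangency point itself.\<close>

lemma tangency_energy_exponential_bounds:
  fixes \<phi> :: "real \<Rightarrow> 'a::euclidean_space"
  assumes pw: "piecewise_Ck 3 \<Omega> fL fR H" and refr: "refracting \<Omega> fL fR H"
    and sol: "filippov_solution \<Omega> fL fR H I \<phi>" and I: "{a..b} \<subseteq> I" and "a < b"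
    and C0: "C \<ge> 0"
    and B: "\<And>t. t \<in> {a<..<b} \<Longrightarrow> \<phi> t \<in> B" "B \<subseteq> \<Omega>"
      "\<And>x. x \<in> B \<Longrightarrow> lie_deriv 2 fL H x > 0"
      "\<And>x. x \<in> B \<Longrightarrow> lie_deriv 2 fR H x < 0"
      "\<And>x. x \<in> B \<Longrightarrow> \<bar>lie_deriv 3 fL H x\<bar> \<le> C * lie_deriv 2 fL H x"
      "\<And>x. x \<in> B \<Longrightarrow> \<bar>lie_deriv 3 fR H x\<bar> \<le> - C * lie_deriv 2 fR H x"
    and notan: "\<And>t. t \<in> {a<..<b} \<Longrightarrow> \<phi> t \<notin> tangency_surface \<Omega> fL H"
  shows "exp (C * a) * tangency_energy fL fR H (\<phi> a) \<le> exp (C * b) * tangency_energy fL fR H (\<phi> b)"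
    and "exp (- C * b) * tangency_energy fL fR H (\<phi> b) \<le> exp (- C * a) * tangency_energy fL fR H (\<phi> a)"
proof -
  have \<Omega>: "open \<Omega>" and Ck: "Ck_on 3 \<Omega> fL" "Ck_on 3 \<Omega> fR" "Ck_on (3 + 1) \<Omega> H"
    using pw by (auto simp: piecewise_Ck_def simp del: Ck_on.simps)
  have H3: "Ck_on 3 \<Omega> H" using Ck(3) Ck_on_Suc_imp[of 3 \<Omega> H] by (simp del: Ck_on.simps)
  note contH = Ck_on_imp_continuous_on[OF H3]
  define Z where "Z = {t \<in> {a..b}. H (\<phi> t) = 0}"
  define g where "g t = tangency_energy fL fR H (\<phi> t)" for t
  define g' where "g' t = (if H (\<phi> t) < 0 then - H (\<phi> t) * lie_deriv 3 fL H (\<phi> t)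
      else - H (\<phi> t) * lie_deriv 3 fR H (\<phi> t))" for t
  have \<phi>\<Omega>: "\<phi> ` {a..b} \<subseteq> \<Omega>"
    using sol I by (auto simp: filippov_solution_def)
  have cont: "continuous_on {a..b} g"
    unfolding g_def
    by (rule continuous_on_compose2[OF tangency_energy_continuous_on[OF pw refr]
          filippov_solution_continuous_on[OF sol I] \<phi>\<Omega>])
  have isolated: "\<exists>\<delta>>0. \<forall>s\<in>Z. dist s t < \<delta> \<longrightarrow> s = t" if t: "t \<in> {a<..<b}" for t
  proof (cases "H (\<phi> t) = 0")
    case True
    have "\<phi> t \<in> \<Omega>" using B t by blast
    with True have \<Sigma>: "\<phi> t \<in> switching_surface \<Omega> H" by (simp add: switching_surface_def)
    have "Ck_on (Suc 2) \<Omega> H" using H3 by (simp only: numeral_3_eq_3 numeral_2_eq_2)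
    then have D: "(H has_derivative frechet_derivative H (at (\<phi> t))) (at (\<phi> t))"
      using \<open>\<phi> t \<in> \<Omega>\<close> by (rule Ck_on_Suc_has_derivative)
    have w: "frechet_derivative H (at (\<phi> t)) (f (\<phi> t)) = lie_deriv 1 f H (\<phi> t)" for f
      using gradient_inner[OF D] by simp
    have isC: "isCont f (\<phi> t)" if "Ck_on 3 \<Omega> f" for f :: "'a \<Rightarrow> 'a"
      using Ck_on_imp_continuous_on[OF that] \<Omega> \<open>\<phi> t \<in> \<Omega>\<close> continuous_on_eq_continuous_at by blast
    \<comment> \<open>Off the tangency surface the crossing is transversal, and refraction gives
      both fields the same nonzero rate of change of \<open>H\<close>, as the isolation lemma
      requires.\<close>
    have "lie_deriv 1 fL H (\<phi> t) \<noteq> 0"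
      using notan[OF t] \<Sigma> by (simp add: tangency_surface_def del: lie_deriv.simps)
    moreover have "lie_deriv 1 fR H (\<phi> t) = lie_deriv 1 fL H (\<phi> t)"
      using refr \<Sigma> by (simp add: refracting_def del: lie_deriv.simps)
    ultimately have "\<exists>\<delta>>0. \<forall>s\<in>{a..b}. H (\<phi> s) = 0 \<longrightarrow> dist s t < \<delta> \<longrightarrow> s = t"
      using t True isC Ck(1,2) D w
      by (intro filippov_solution_isolated_crossing[OF sol I,
            where D = "frechet_derivative H (at (\<phi> t))" and w = "lie_deriv 1 fL H (\<phi> t)"])
        (auto simp del: lie_deriv.simps)
    then show ?thesis by (auto simp: Z_def)
  next
    case False
    have "continuous_on {a..b} (\<lambda>t. H (\<phi> t))"
      by (rule continuous_on_compose2[OF contH filippov_solution_continuous_on[OF sol I] \<phi>\<Omega>])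
    then obtain \<delta> where "\<delta> > 0" "\<And>s. s \<in> {a..b} \<Longrightarrow> dist s t < \<delta> \<Longrightarrow> dist (H (\<phi> s)) (H (\<phi> t)) < \<bar>H (\<phi> t)\<bar>"
      using t False unfolding continuous_on_iff
      by (metis atLeastAtMost_iff greaterThanLessThan_iff less_imp_le zero_less_abs_iff)
    then have "H (\<phi> s) \<noteq> 0" if "s \<in> {a..b}" "dist s t < \<delta>" for s
      using that by (fastforce simp: dist_real_def)
    with \<open>\<delta> > 0\<close> show ?thesis by (auto simp: Z_def)
  qed
  have off: "(g has_real_derivative g' t) (at t) \<and> \<bar>g' t\<bar> \<le> C * g t" if t: "t \<in> {a<..<b} - Z" for t
  proof -
    have tab: "t \<in> {a<..<b}" and "\<phi> t \<in> B" "\<phi> t \<in> \<Omega>" using t B by auto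
    have contHt: "((\<lambda>s. H (\<phi> s)) \<longlongrightarrow> H (\<phi> t)) (nhds t)" if "(\<phi> has_vector_derivative v) (at t)" for v
    proof -
      have "isCont \<phi> t" using that has_vector_derivative_continuous by blast
      moreover have "isCont H (\<phi> t)"
        using contH \<Omega> \<open>\<phi> t \<in> \<Omega>\<close> continuous_on_eq_continuous_at by blast
      ultimately show ?thesis
        using isCont_o2[of t \<phi> H] by (simp add: isCont_def tendsto_nhds_iff)
    qed
    have square: "(lie_deriv 1 f H (\<phi> t))\<^sup>2 / 2 \<ge> 0" for f by simp
    have "open {x \<in> \<Omega>. H x < 0}" "open {x \<in> \<Omega>. H x > 0}"
      using continuous_on_open_vimage[OF \<Omega>, of H] contH
      by (auto simp: vimage_def Int_def conj_commute dest: spec[of _ "{..<0}"] spec[of _ "{0<..}"])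
    have "H (\<phi> t) \<noteq> 0" using t by (auto simp: Z_def)
    then consider (neg) "H (\<phi> t) < 0" | (pos) "H (\<phi> t) > 0" by linarith
    then show ?thesis
    proof cases
      case neg
      have \<phi>': "(\<phi> has_vector_derivative fL (\<phi> t)) (at t)"
      proof (rule filippov_solution_has_vector_derivative[OF sol I tab])
        show "open {x \<in> \<Omega>. H x < 0}" by fact
        show "continuous_on {x \<in> \<Omega>. H x < 0} fL"
          using Ck_on_imp_continuous_on[OF Ck(1)] by (rule continuous_on_subset) blast
      qed (use neg \<open>\<phi> t \<in> \<Omega>\<close> in \<open>auto simp: filippov_set_def\<close>)
      have "eventually (\<lambda>s. H (\<phi> s) < 0) (nhds t)"
        by (rule order_tendstoD(2)[OF contHt[OF \<phi>'] neg])
      \<comment> \<open>The energy agrees with the \<open>fL\<close> branch in a whole neighbourhood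
        of \<open>t\<close>, so the derivative of that branch carries over.\<close>
      then have "eventually (\<lambda>s. g s = (lie_deriv 1 fL H (\<phi> s))\<^sup>2 / 2 - H (\<phi> s) * lie_deriv 2 fL H (\<phi> s)) (nhds t)"
        by eventually_elim (simp add: g_def tangency_energy_def)
      then have "(g has_real_derivative - H (\<phi> t) * lie_deriv 3 fL H (\<phi> t)) (at t)"
        using half_energy_along_solution[OF \<Omega> H3 Ck(1) \<open>\<phi> t \<in> \<Omega>\<close> \<phi>']
        by (rule DERIV_cong_ev[OF refl _ refl, THEN iffD2])
      then have "(g has_real_derivative g' t) (at t)"
        using neg by (simp add: g'_def)
      moreover have "\<bar>g' t\<bar> \<le> C * g t"
      proof -
        have "\<bar>g' t\<bar> = - H (\<phi> t) * \<bar>lie_deriv 3 fL H (\<phi> t)\<bar>"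
          using neg by (simp add: g'_def abs_mult del: lie_deriv.simps)
        also have "\<dots> \<le> - H (\<phi> t) * (C * lie_deriv 2 fL H (\<phi> t))"
          using neg B(5)[OF \<open>\<phi> t \<in> B\<close>] by (intro mult_left_mono) auto
        also have "\<dots> = C * (- H (\<phi> t) * lie_deriv 2 fL H (\<phi> t))" by (simp only: mult_ac)
        \<comment> \<open>The energy is this product plus a nonnegative square.\<close>
        also have "\<dots> \<le> C * g t"
          using neg square C0 by (intro mult_left_mono) (auto simp: g_def tangency_energy_def simp del: lie_deriv.simps)
        finally show ?thesis .
      qed
      ultimately show ?thesis ..
    next
      case pos
      have \<phi>': "(\<phi> has_vector_derivative fR (\<phi> t)) (at t)"
      proof (rule filippov_solution_has_vector_derivative[OF sol I tab])
        show "open {x \<in> \<Omega>. H x > 0}" by fact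
        show "continuous_on {x \<in> \<Omega>. H x > 0} fR"
          using Ck_on_imp_continuous_on[OF Ck(2)] by (rule continuous_on_subset) blast
      qed (use pos \<open>\<phi> t \<in> \<Omega>\<close> in \<open>auto simp: filippov_set_def\<close>)
      have "eventually (\<lambda>s. H (\<phi> s) > 0) (nhds t)"
        by (rule order_tendstoD(1)[OF contHt[OF \<phi>'] pos])
      then have "eventually (\<lambda>s. g s = (lie_deriv 1 fR H (\<phi> s))\<^sup>2 / 2 - H (\<phi> s) * lie_deriv 2 fR H (\<phi> s)) (nhds t)"
        by eventually_elim (simp add: g_def tangency_energy_def)
      then have "(g has_real_derivative - H (\<phi> t) * lie_deriv 3 fR H (\<phi> t)) (at t)"
        using half_energy_along_solution[OF \<Omega> H3 Ck(2) \<open>\<phi> t \<in> \<Omega>\<close> \<phi>']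
        by (rule DERIV_cong_ev[OF refl _ refl, THEN iffD2])
      then have "(g has_real_derivative g' t) (at t)"
        using pos by (simp add: g'_def)
      moreover have "\<bar>g' t\<bar> \<le> C * g t"
      proof -
        have "\<bar>g' t\<bar> = H (\<phi> t) * \<bar>lie_deriv 3 fR H (\<phi> t)\<bar>"
          using pos by (simp add: g'_def abs_mult del: lie_deriv.simps)
        also have "\<dots> \<le> H (\<phi> t) * (- C * lie_deriv 2 fR H (\<phi> t))"
          using pos B(6)[OF \<open>\<phi> t \<in> B\<close>] by (intro mult_left_mono) auto
        also have "\<dots> = C * (- H (\<phi> t) * lie_deriv 2 fR H (\<phi> t))" by simp
        also have "\<dots> \<le> C * g t"
          using pos square C0 by (intro mult_left_mono) (auto simp: g_def tangency_energy_def simp del: lie_deriv.simps)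
        finally show ?thesis .
      qed
      ultimately show ?thesis ..
    qed
  qed
  note * = exponential_bounds[OF \<open>a < b\<close> cont isolated off[THEN conjunct1] off[THEN conjunct2]]
  show "exp (C * a) * tangency_energy fL fR H (\<phi> a) \<le> exp (C * b) * tangency_energy fL fR H (\<phi> b)"
    using *(1) by (simp add: g_def)
  show "exp (- C * b) * tangency_energy fL fR H (\<phi> b) \<le> exp (- C * a) * tangency_energy fL fR H (\<phi> a)"
    using *(2) by (simp add: g_def)
qed

section \<open>First hitting points\<close>

text \<open>Treats both time directions at once: \<open>I\<close> lies on one side of 0, and
  absolute values measure time from the start. Existence of a first hit comes from compactness, its
  character from the energy.\<close>

lemma first_hitting_not_invisible_invisible:
  fixes \<phi> :: "real \<Rightarrow> 'a::euclidean_space"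
  assumes pw: "piecewise_Ck 3 \<Omega> fL fR H" and refr: "refracting \<Omega> fL fR H"
    and sol: "filippov_solution \<Omega> fL fR H I \<phi>"
    and I: "0 \<in> I" "I \<subseteq> {0..} \<or> I \<subseteq> {..0}"
    and start: "\<phi> 0 \<notin> tangency_surface \<Omega> fL H"
    and hit: "t1 \<in> I" "\<phi> t1 \<in> tangency_surface \<Omega> fL H"
  shows "\<exists>\<tau>. first_hitting_time I \<phi> (tangency_surface \<Omega> fL H) \<tau> \<and>
    \<not> (\<exists>S. invisible_invisible_region \<Omega> fL fR H S \<and> \<phi> \<tau> \<in> S)"
proof -
  let ?T = "tangency_surface \<Omega> fL H"
  have \<Omega>: "open \<Omega>" and Ck: "Ck_on 3 \<Omega> fL" "Ck_on (3 + 1) \<Omega> H"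
    using pw by (auto simp: piecewise_Ck_def simp del: Ck_on.simps)
  \<comment> \<open>The compact time interval between the start and the given hit, in either
    direction.\<close>
  define c d where "c = min 0 t1" "d = max 0 t1"
  have "c \<in> I" "d \<in> I"
    using I(1) hit(1) by (simp_all add: c_d_def min_def max_def)
  moreover have "is_interval I" using sol by (simp add: filippov_solution_def)
  ultimately have "{c..d} \<subseteq> I"
    unfolding is_interval_1 by (meson atLeastAtMost_iff subsetI)
  then have cd: "{c..d} \<subseteq> I" "0 \<in> {c..d}" "t1 \<in> {c..d}"
    by (simp_all add: c_d_def)
  have cont: "continuous_on {c..d} \<phi>"
    using filippov_solution_continuous_on[OF sol cd(1)] .
  have \<phi>\<Omega>: "\<phi> ` {c..d} \<subseteq> \<Omega>" "\<phi> ` I \<subseteq> \<Omega>"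
    using sol cd(1) by (auto simp: filippov_solution_def)
  define K where "K = {t \<in> {c..d}. H (\<phi> t) = 0} \<inter> {t \<in> {c..d}. lie_deriv 1 fL H (\<phi> t) = 0}"
  have K: "t \<in> K \<longleftrightarrow> t \<in> {c..d} \<and> \<phi> t \<in> ?T" for t
    using \<phi>\<Omega> by (auto simp: K_def tangency_surface_def switching_surface_def)
  have "continuous_on {c..d} (\<lambda>t. lie_deriv m fL H (\<phi> t))" if "m \<le> 3" for m
    by (rule continuous_on_compose2[OF lie_deriv_continuous_on[OF \<Omega> Ck that] cont \<phi>\<Omega>(1)])
  from this[of 0] this[of 1] have "closed K"
    unfolding K_def by (intro closed_Int continuous_closed_preimage_constant) simp_all
  moreover have "K \<subseteq> {c..d}" by (auto simp: K_def)
  ultimately have "compact K"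
    using compact_Int_closed[of "{c..d}" K] by (simp add: Int_absorb1)
  moreover have "K \<noteq> {}" using K cd(3) hit(2) by blast
  \<comment> \<open>The first hit minimizes the distance to time 0 over the compact nonempty set of
    tangency times.\<close>
  ultimately obtain \<tau> where "\<tau> \<in> K" and \<tau>min: "\<And>t. t \<in> K \<Longrightarrow> \<bar>\<tau>\<bar> \<le> \<bar>t\<bar>"
    using continuous_attains_inf[of K abs] continuous_on_rabs[OF continuous_on_id] by blast
  have \<tau>: "\<tau> \<in> {c..d}" "\<tau> \<in> I" "\<phi> \<tau> \<in> ?T" "\<phi> \<tau> \<in> \<Omega>"
    using \<open>\<tau> \<in> K\<close> K cd(1) \<phi>\<Omega> by auto
  have first: "\<bar>\<tau>\<bar> \<le> \<bar>t\<bar>" if "t \<in> I" "\<phi> t \<in> ?T" for t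
  proof (cases "t \<in> {c..d}")
    case True
    then show ?thesis using \<tau>min K that by blast
  next
    case False
    \<comment> \<open>As \<open>I\<close> lies on one side of 0, a time of \<open>I\<close> outside
      \<open>{c..d}\<close> lies beyond \<open>t1\<close>.\<close>
    then have "\<bar>t1\<bar> \<le> \<bar>t\<bar>"
      using I(2) that(1) hit(1) by (auto simp: c_d_def)
    moreover have "\<bar>\<tau>\<bar> \<le> \<bar>t1\<bar>" using \<tau>min K cd(3) hit(2) by blast
    ultimately show ?thesis by simp
  qed
  have notan: "\<phi> t \<notin> ?T" if "t \<in> {c..d}" "\<bar>t\<bar> < \<bar>\<tau>\<bar>" for t
    using first[of t] that cd(1) by (meson not_less subsetD)
  have "\<not> (\<exists>S. invisible_invisible_region \<Omega> fL fR H S \<and> \<phi> \<tau> \<in> S)"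
  proof
    assume "\<exists>S. invisible_invisible_region \<Omega> fL fR H S \<and> \<phi> \<tau> \<in> S"
    then have "lie_deriv 2 fL H (\<phi> \<tau>) > 0" "lie_deriv 2 fR H (\<phi> \<tau>) < 0"
      by (auto simp: invisible_invisible_region_def simp del: lie_deriv.simps)
    from invisible_invisible_neighbourhood[OF pw \<tau>(4) this]
    obtain B C where BC: "C \<ge> 0" "open B" "\<phi> \<tau> \<in> B" and B: "B \<subseteq> \<Omega>"
      "\<And>x. x \<in> B \<Longrightarrow> lie_deriv 2 fL H x > 0"
      "\<And>x. x \<in> B \<Longrightarrow> lie_deriv 2 fR H x < 0"
      "\<And>x. x \<in> B \<Longrightarrow> \<bar>lie_deriv 3 fL H x\<bar> \<le> C * lie_deriv 2 fL H x"
      "\<And>x. x \<in> B \<Longrightarrow> \<bar>lie_deriv 3 fR H x\<bar> \<le> - C * lie_deriv 2 fR H x"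
      by metis
    obtain r where "r > 0" and r: "\<And>y. dist y (\<phi> \<tau>) < r \<Longrightarrow> y \<in> B"
      using BC(2,3) unfolding open_dist by blast
    obtain \<delta> where "\<delta> > 0" and \<delta>: "\<And>t. t \<in> {c..d} \<Longrightarrow> dist t \<tau> < \<delta> \<Longrightarrow> \<phi> t \<in> B"
      using cont \<tau>(1) \<open>r > 0\<close> r unfolding continuous_on_iff by metis
    have pos: "tangency_energy fL fR H (\<phi> t) > 0"
      if "t \<in> {c..d}" "dist t \<tau> < \<delta>" "\<bar>t\<bar> < \<bar>\<tau>\<bar>" for t
    proof (rule tangency_energy_pos[OF refr])
      show "\<phi> t \<notin> ?T" using that by (intro notan)
    qed (use B \<delta>[OF that(1,2)] in auto)
    have zero: "tangency_energy fL fR H (\<phi> \<tau>) = 0"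
      using \<tau>(3) by (rule tangency_energy_eq_0)
    have "\<tau> \<noteq> 0" using start \<tau>(3) by metis
    then consider "\<tau> > 0" | "\<tau> < 0" by linarith
    then show False
    proof cases
      case 1
      \<comment> \<open>Halving \<open>\<delta>\<close> keeps \<open>a\<close> strictly within
        \<open>\<delta>\<close> of \<open>\<tau>\<close>, and the maximum keeps it from preceding
        the start. The energy is positive at \<open>a\<close> and zero at \<open>\<tau>\<close>,
        against the forward bound.\<close>
      define a where "a = max 0 (\<tau> - \<delta>/2)"
      have a: "0 \<le> a" "a < \<tau>" "\<tau> - a < \<delta>" using 1 \<open>\<delta> > 0\<close> by (auto simp: a_def)
      have sub: "{a..\<tau>} \<subseteq> {c..d}" using a cd(2) \<tau>(1) by auto
      have "exp (C * a) * tangency_energy fL fR H (\<phi> a) \<le> exp (C * \<tau>) * tangency_energy fL fR H (\<phi> \<tau>)"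
      proof (rule tangency_energy_exponential_bounds(1)[OF pw refr sol _ a(2) BC(1) _ B])
        show "{a..\<tau>} \<subseteq> I" using sub cd(1) by blast
        show "\<phi> t \<in> B" if "t \<in> {a<..<\<tau>}" for t
          using that sub a by (intro \<delta>) (auto simp: dist_real_def)
        show "\<phi> t \<notin> ?T" if "t \<in> {a<..<\<tau>}" for t
          using that sub a by (intro notan) auto
      qed
      moreover have "tangency_energy fL fR H (\<phi> a) > 0"
        using sub a by (intro pos) (auto simp: dist_real_def)
      ultimately show False
        using zero by (simp add: mult_le_0_iff)
    next
      case 2
      \<comment> \<open>Mirror image: in increasing time the tangency is now the left end, so the
        second exponential bound applies.\<close>
      define b where "b = min 0 (\<tau> + \<delta>/2)"
      have b: "b \<le> 0" "\<tau> < b" "b - \<tau> < \<delta>" using 2 \<open>\<delta> > 0\<close> by (auto simp: b_def)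
      have sub: "{\<tau>..b} \<subseteq> {c..d}" using b cd(2) \<tau>(1) by auto
      have "exp (- C * b) * tangency_energy fL fR H (\<phi> b) \<le> exp (- C * \<tau>) * tangency_energy fL fR H (\<phi> \<tau>)"
      proof (rule tangency_energy_exponential_bounds(2)[OF pw refr sol _ b(2) BC(1) _ B])
        show "{\<tau>..b} \<subseteq> I" using sub cd(1) by blast
        show "\<phi> t \<in> B" if "t \<in> {\<tau><..<b}" for t
          using that sub b by (intro \<delta>) (auto simp: dist_real_def)
        show "\<phi> t \<notin> ?T" if "t \<in> {\<tau><..<b}" for t
          using that sub b by (intro notan) auto
      qed
      moreover have "tangency_energy fL fR H (\<phi> b) > 0"
        using sub b by (intro pos) (auto simp: dist_real_def)
      ultimately show False
        using zero by (simp add: mult_le_0_iff)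
    qed
  qed
  then show ?thesis
    using \<tau> first unfolding first_hitting_time_def by blast
qed

text \<open>Reaching the tangency surface in finite time means that some time of \<open>I\<close>
  does so. The two conjuncts are the two alternatives for the side of 0 on which \<open>I\<close>
  lies.\<close>

theorem theorem5p2:
  fixes \<Omega> :: "(real^'n) set"
    and fL fR :: "real^'n \<Rightarrow> real^'n"
    and H :: "real^'n \<Rightarrow> real"
    and x :: "real^'n"
  assumes "piecewise_Ck 3 \<Omega> fL fR H"
    and "refracting \<Omega> fL fR H"
    and "x \<in> \<Omega> - tangency_surface \<Omega> fL H"
  shows "(\<forall>I \<phi>. forward_orbit \<Omega> fL fR H x I \<phi> \<and> (\<exists>t\<in>I. \<phi> t \<in> tangency_surface \<Omega> fL H) \<longrightarrow>
            (\<exists>\<tau>. first_hitting_time I \<phi> (tangency_surface \<Omega> fL H) \<tau> \<and>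
                 \<not> (\<exists>S. invisible_invisible_region \<Omega> fL fR H S \<and> \<phi> \<tau> \<in> S))) \<and>
         (\<forall>I \<phi>. backward_orbit \<Omega> fL fR H x I \<phi> \<and> (\<exists>t\<in>I. \<phi> t \<in> tangency_surface \<Omega> fL H) \<longrightarrow>
            (\<exists>\<tau>. first_hitting_time I \<phi> (tangency_surface \<Omega> fL H) \<tau> \<and>
                 \<not> (\<exists>S. invisible_invisible_region \<Omega> fL fR H S \<and> \<phi> \<tau> \<in> S)))"
  using first_hitting_not_invisible_invisible[OF assms(1,2)] assms(3)
  unfolding forward_orbit_def backward_orbit_def by blast

end
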